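(* Let $p,q\in(1,\infty)$ be admissible, that is, $\frac1p+\frac1q\le1$. Then the set $M:=\{\mathcal{L}u:u\in C^{1,2}_0\}$ is not dense in $L_{(p,q)}$ (that is, the closure in $L_{(p,q)}$ of $M\cap L_{(p,q)}$ is not all of $L_{(p,q)}$).
   Context: Fix $\nu\in(1/2,1)$. Let $\partial_t=\partial/\partial t$, $D=\partial/\partial x$, $b(t,x)=I_{t>0}\,t^{-\nu}\operatorname{sign}x$ and $\mathcal{L}u=\partial_tu+\tfrac12D^2u+b\,Du$; here $\mathcal{L}u$ is considered as a function on $(0,1)\times\mathbb{R}$. For $p,q\in(1,\infty)$, $L_{(p,q)}$ is the space of (measurable, up to a.e. equality) functions $f(t,x)$ on $(0,1)\times\mathbb{R}$ with finite norm $$\|f\|_{L_{(p,q)}}=\Big(\int_0^1\Big(\int_{\mathbb{R}}|f(t,x)|^p\,dx\Big)^{q/p}dt\Big)^{1/q}\ \text{ if } p\ge q,$$ $$\|f\|_{L_{(p,q)}}=\Big(\int_{\mathbb{R}}\Big(\int_0^1|f(t,x)|^q\,dt\Big)^{p/q}dx\Big)^{1/p}\ \text{ if } p\le q.$$ $C^{1,2}_0$ is the set of continuous functions $u$ on $[0,1]\times\mathbb{R}$ whose partial derivatives $\partial_tu,D^2u,Du$ are continuous and bounded in $[0,1]\times\mathbb{R}$, such that $u(1,\cdot)=0$ and $u(t,x)=0$ if $|x|$ is large. *)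

theory Defs
  imports "HOL-Analysis.Analysis"
begin

text \<open>
  A point of the plane is a pair \<open>(t, x)\<close>. Functions on \<open>(0,1) \<times> \<real>\<close> or on \<open>[0,1] \<times> \<real>\<close> are
  represented by total functions; their values outside the respective strip never matter.
\<close>

abbreviation open_strip :: "(real \<times> real) set"
  where "open_strip \<equiv> {0<..<1} \<times> UNIV"

abbreviation closed_strip :: "(real \<times> real) set"
  where "closed_strip \<equiv> {0..1} \<times> UNIV"


subsection \<open>Mixed-norm Lebesgue spaces\<close>

text \<open>
  Real powers of extended nonnegative numbers, meant for exponents \<open>e > 0\<close>, where
  \<open>\<infinity>\<close> raised to the power \<open>e\<close> is \<open>\<infinity>\<close>.
\<close>

definition ennpowr :: "ennreal \<Rightarrow> real \<Rightarrow> ennreal"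
  where "ennpowr a e = (if a = top then top else ennreal (enn2real a powr e))"

definition Lpq_norm :: "real \<Rightarrow> real \<Rightarrow> (real \<times> real \<Rightarrow> real) \<Rightarrow> ennreal"
  where "Lpq_norm p q f =
    (if p \<ge> q
     then ennpowr (\<integral>\<^sup>+ t \<in> {0<..<1}.
            ennpowr (\<integral>\<^sup>+ x. ennreal (\<bar>f (t, x)\<bar> powr p) \<partial>lebesgue) (q / p) \<partial>lebesgue) (1 / q)
     else ennpowr (\<integral>\<^sup>+ x.
            ennpowr (\<integral>\<^sup>+ t \<in> {0<..<1}. ennreal (\<bar>f (t, x)\<bar> powr q) \<partial>lebesgue) (p / q) \<partial>lebesgue) (1 / p))"

definition Lpq :: "real \<Rightarrow> real \<Rightarrow> (real \<times> real \<Rightarrow> real) set"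
  where "Lpq p q = {f. f \<in> borel_measurable (lebesgue_on open_strip) \<and> Lpq_norm p q f < top}"

text \<open>
  Functions are not identified modulo almost-everywhere equality; instead \<open>Lpq_norm\<close> is used as
  a seminorm. The closure below is invariant under a.e. equality on the strip, so it is all of
  \<open>Lpq p q\<close> iff the corresponding set of equivalence classes is dense in the quotient.
\<close>

definition Lpq_closure :: "real \<Rightarrow> real \<Rightarrow> (real \<times> real \<Rightarrow> real) set \<Rightarrow> (real \<times> real \<Rightarrow> real) set"
  where "Lpq_closure p q A =
    {f \<in> Lpq p q. \<forall>e>0. \<exists>g\<in>A. Lpq_norm p q (\<lambda>z. f z - g z) < ennreal e}"


subsection \<open>Partial derivatives and the class of test functions\<close>

text \<open>The time derivative is one-sided at \<open>t = 0\<close> and \<open>t = 1\<close> and two-sided in between.\<close>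

definition Dt :: "(real \<times> real \<Rightarrow> real) \<Rightarrow> real \<times> real \<Rightarrow> real"
  where "Dt u = (\<lambda>(t, x). vector_derivative (\<lambda>s. u (s, x)) (at t within {0..1}))"

definition Dx :: "(real \<times> real \<Rightarrow> real) \<Rightarrow> real \<times> real \<Rightarrow> real"
  where "Dx u = (\<lambda>(t, x). deriv (\<lambda>y. u (t, y)) x)"

definition C12_0 :: "(real \<times> real \<Rightarrow> real) set"
  where "C12_0 = {u.
    continuous_on closed_strip u \<and>
    (\<forall>t\<in>{0..1}. \<forall>x.
       (\<lambda>s. u (s, x)) differentiable (at t within {0..1}) \<and>
       (\<lambda>y. u (t, y)) differentiable (at x) \<and>
       (\<lambda>y. Dx u (t, y)) differentiable (at x)) \<and>
    (\<forall>v \<in> {Dt u, Dx u, Dx (Dx u)}. continuous_on closed_strip v \<and> bounded (v ` closed_strip)) \<and>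
    (\<forall>x. u (1, x) = 0) \<and>
    (\<exists>R. \<forall>t\<in>{0..1}. \<forall>x. \<bar>x\<bar> > R \<longrightarrow> u (t, x) = 0)}"


subsection \<open>The operator\<close>

definition drift :: "real \<Rightarrow> real \<times> real \<Rightarrow> real"
  where "drift \<nu> = (\<lambda>(t, x). if t > 0 then t powr (- \<nu>) * sgn x else 0)"

definition Lop :: "real \<Rightarrow> (real \<times> real \<Rightarrow> real) \<Rightarrow> real \<times> real \<Rightarrow> real"
  where "Lop \<nu> u = (\<lambda>z. Dt u z + 1 / 2 * Dx (Dx u) z + drift \<nu> z * Dx u z)"

end

theory Submission
  imports Defs "HOL-Probability.Distributions"
begin

text \<open>
  Because \<open>\<nu> > 1/2\<close>, the drift \<open>t powr (- \<nu>) * sgn x\<close> beats the diffusion near the origin: a particle that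
  starts at the origin escapes along \<open>front \<nu> t\<close> or along its negative, and it returns to \<open>0\<close> with
  probability less than one. So the stochastic equation has more than one solution from \<open>(0, 0)\<close>, and the
  difference of the two Green measures annihilates the range of the operator while belonging to the dual of
  \<open>Lpq p q\<close>. The proof realises this on the level of functions, without constructing either solution.

  On the half strip \<open>x > 0\<close>, a solution of \<open>L v = f\<close> that vanishes at \<open>x = 0\<close> and at \<open>t = 1\<close> need not tend to
  \<open>0\<close> at the origin: the function \<open>barrier\<close> is an explicit subsolution, nonpositive at \<open>x = 0\<close>, at \<open>t = 1\<close>
  and for large \<open>x\<close>, with generator at least \<open>- \<Psi>\<close> (\<open>generator_barrier_bounded_below\<close>), which tends to \<open>1\<close>
  along the front (see \<open>barrier_near_front\<close>). Let \<open>source\<close> be the odd function equal to \<open>- \<Psi>\<close> on a bounded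
  part of the right half strip, let \<open>u\<close> be a test function and let \<open>e = source - L u\<close>. The odd part of \<open>u\<close>
  vanishes at \<open>x = 0\<close> and is continuous at the origin, whereas the barrier is not. Comparing the two, with
  a smooth convex truncation in place of the maximum principle, yields a nonnegative function \<open>excess\<close> whose generator is
  at least \<open>- (\<bar>e (t, x)\<bar> + \<bar>e (t, - x)\<bar>) / 2\<close> (\<open>excess_generator_ge\<close>).

  Integrating against the Gaussian density of the Brownian motion that is carried along the front
  (\<open>parabolic_duality\<close>) bounds the mass of the excess near the initial time by the integral of that density,
  symmetrized, against \<open>\<bar>e\<bar>\<close> (\<open>excess_integral_le\<close>). That mass is bounded below independently of \<open>u\<close>
  (\<open>excess_initial_mass_ge\<close>). For admissible \<open>p\<close> and \<open>q\<close> the density belongs to the dual mixed-norm space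
  (\<open>kernel_pairing_bounded\<close>), so the norm of \<open>e\<close> is bounded below as well, and \<open>source\<close> is not in the closure.
\<close>


section \<open>Hoelder's inequality and heat-type kernels in mixed-norm spaces\<close>

lemma ennpowr_top [simp]: "ennpowr top e = top"
  by (simp add: ennpowr_def)

lemma ennpowr_zero [simp]: "ennpowr 0 e = 0"
  by (simp add: ennpowr_def)

lemma ennpowr_ennreal [simp]: "0 \<le> a \<Longrightarrow> ennpowr (ennreal a) e = ennreal (a powr e)"
  by (simp add: ennpowr_def)

lemma ennpowr_measurable [measurable]: "(\<lambda>a. ennpowr a e) \<in> borel_measurable borel"
  unfolding ennpowr_def by measurable

lemma ennpowr_mono: "a \<le> b \<Longrightarrow> 0 \<le> e \<Longrightarrow> ennpowr a e \<le> ennpowr b e"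
  by (cases a; cases b) (auto simp: powr_mono2 top_unique)

lemma ennpowr_ennpowr: "ennpowr (ennpowr a r) s = ennpowr a (r * s)"
  by (cases a) (auto simp: powr_powr)

lemma ennpowr_one [simp]: "ennpowr a 1 = a"
  by (cases a) auto

lemma ennpowr_add: "ennpowr a (r + s) = ennpowr a r * ennpowr a s"
  by (cases a) (auto simp: powr_add ennreal_mult ennreal_top_mult)

lemma ennpowr_less_top [simp]: "ennpowr a e < top \<longleftrightarrow> a < top"
  by (cases a) auto

lemma ennpowr_eq_0_iff [simp]: "ennpowr a e = 0 \<longleftrightarrow> a = 0"
  by (cases a) auto

lemma ennpowr_mult_indicator:
  "ennpowr (a * indicator A x) e = ennpowr a e * indicator A x"
  by (auto simp: indicator_def)

text \<open>
  Young's inequality after rescaling \<open>a\<close> by \<open>1/\<alpha>\<close> and \<open>b\<close> by \<open>1/\<beta>\<close>. The scales are free so that they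
  can be set to the norms of the two functions in Hoelder's inequality.
\<close>

lemma ennreal_Young_weighted:
  fixes a b :: ennreal and \<alpha> \<beta> p q :: real
  assumes "1 < p" "1 < q" "1/p + 1/q = 1" "0 < \<alpha>" "0 < \<beta>"
  shows "a * b \<le> ennreal (\<alpha> * \<beta> / (p * \<alpha> powr p)) * ennpowr a p + ennreal (\<alpha> * \<beta> / (q * \<beta> powr q)) * ennpowr b q"
proof (cases "a = top \<or> b = top")
  case True
  have "0 < \<alpha> * \<beta> / (p * \<alpha> powr p)" "0 < \<alpha> * \<beta> / (q * \<beta> powr q)"
    using assms by auto
  then show ?thesis using True by (auto simp: ennreal_mult_top)
next
  case False
  then obtain x y where xy: "a = ennreal x" "0 \<le> x" "b = ennreal y" "0 \<le> y"
    by (metis ennreal_cases)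
  have "(x / \<alpha>) * (y / \<beta>) \<le> (x / \<alpha>) powr p / p + (y / \<beta>) powr q / q"
    using assms xy by (intro Youngs_inequality) auto
  then have "\<alpha> * \<beta> * ((x / \<alpha>) * (y / \<beta>)) \<le> \<alpha> * \<beta> * ((x / \<alpha>) powr p / p + (y / \<beta>) powr q / q)"
    using assms by (intro mult_left_mono) auto
  also have "\<dots> = \<alpha> * \<beta> / (p * \<alpha> powr p) * x powr p + \<alpha> * \<beta> / (q * \<beta> powr q) * y powr q"
    using assms xy by (simp add: powr_divide field_simps)
  finally have "x * y \<le> \<alpha> * \<beta> / (p * \<alpha> powr p) * x powr p + \<alpha> * \<beta> / (q * \<beta> powr q) * y powr q"
    using assms by simp
  then show ?thesis
    using assms xy by (simp add: ennreal_mult[symmetric] ennreal_plus[symmetric] del: ennreal_plus)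
qed

lemma nn_integral_Holder:
  fixes f g :: "'a \<Rightarrow> ennreal" and p q :: real
  assumes pq: "1 < p" "1 < q" "1/p + 1/q = 1"
    and [measurable]: "f \<in> borel_measurable M" "g \<in> borel_measurable M"
  shows "(\<integral>\<^sup>+x. f x * g x \<partial>M) \<le>
     ennpowr (\<integral>\<^sup>+x. ennpowr (f x) p \<partial>M) (1/p) * ennpowr (\<integral>\<^sup>+x. ennpowr (g x) q \<partial>M) (1/q)"
proof -
  define A where "A = (\<integral>\<^sup>+x. ennpowr (f x) p \<partial>M)"
  define B where "B = (\<integral>\<^sup>+x. ennpowr (g x) q \<partial>M)"
  consider "A = 0" | "B = 0" | "A \<noteq> 0" "B \<noteq> 0" "A = top \<or> B = top"
    | "0 < A" "A < top" "0 < B" "B < top"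
    by (metis less_top not_gr_zero)
  then have "(\<integral>\<^sup>+x. f x * g x \<partial>M) \<le> ennpowr A (1/p) * ennpowr B (1/q)"
  proof cases
    case 1
    then have "AE x in M. f x = 0"
      unfolding A_def by (subst (asm) nn_integral_0_iff_AE) auto
    then have "(\<integral>\<^sup>+x. f x * g x \<partial>M) = (\<integral>\<^sup>+x. 0 \<partial>M)"
      by (intro nn_integral_cong_AE) auto
    then show ?thesis by simp
  next
    case 2
    then have "AE x in M. g x = 0"
      unfolding B_def by (subst (asm) nn_integral_0_iff_AE) auto
    then have "(\<integral>\<^sup>+x. f x * g x \<partial>M) = (\<integral>\<^sup>+x. 0 \<partial>M)"
      by (intro nn_integral_cong_AE) auto
    then show ?thesis by simp
  next
    case 3
    then show ?thesis by (auto simp: ennreal_mult_eq_top_iff ennreal_top_mult ennreal_mult_top)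
  next
    case 4
    obtain a where a: "A = ennreal a" "0 < a"
      using 4 by (cases A) auto
    obtain b where b: "B = ennreal b" "0 < b"
      using 4 by (cases B) auto
    define \<alpha> where "\<alpha> = a powr (1/p)"
    define \<beta> where "\<beta> = b powr (1/q)"
    have ab: "0 < \<alpha>" "0 < \<beta>" "\<alpha> powr p = a" "\<beta> powr q = b"
      using a b pq by (auto simp: \<alpha>_def \<beta>_def powr_powr)
    have "(\<integral>\<^sup>+x. f x * g x \<partial>M) \<le> (\<integral>\<^sup>+x. ennreal (\<alpha> * \<beta> / (p * \<alpha> powr p)) * ennpowr (f x) p
        + ennreal (\<alpha> * \<beta> / (q * \<beta> powr q)) * ennpowr (g x) q \<partial>M)"
      by (intro nn_integral_mono ennreal_Young_weighted pq ab)
    also have "\<dots> = ennreal (\<alpha> * \<beta> / (p * a)) * A + ennreal (\<alpha> * \<beta> / (q * b)) * B"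
      by (simp add: nn_integral_add nn_integral_cmult A_def B_def ab)
    also have "\<dots> = ennreal (\<alpha> * \<beta> / (p * a) * a + \<alpha> * \<beta> / (q * b) * b)"
      using a b ab pq by (simp add: ennreal_mult[symmetric] ennreal_plus[symmetric] del: ennreal_plus)
    also have "\<alpha> * \<beta> / (p * a) * a + \<alpha> * \<beta> / (q * b) * b = \<alpha> * \<beta> * (1/p + 1/q)"
      using a b by (simp add: field_simps)
    also have "\<dots> = \<alpha> * \<beta>" using pq(3) by simp
    also have "ennreal (\<alpha> * \<beta>) = ennpowr A (1/p) * ennpowr B (1/q)"
      using a b ab by (simp add: ennreal_mult \<alpha>_def \<beta>_def)
    finally show ?thesis .
  qed
  then show ?thesis by (simp add: A_def B_def)
qed

lemma nn_integral_powr_01_finite: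
  fixes a :: real
  assumes "a < 1"
  shows "(\<integral>\<^sup>+t\<in>{0<..<1}. ennreal (t powr (- a)) \<partial>lborel) < top"
proof -
  have "((\<lambda>t. t powr (-a)) has_integral (1 powr (-a+1) / (-a+1))) {0..1::real}"
    using assms by (intro has_integral_powr_from_0) auto
  then have "(\<integral>\<^sup>+t. ennreal (t powr (- a)) * indicator {0..1} t \<partial>lborel) = ennreal (1 powr (-a+1) / (-a+1))"
    by (intro nn_integral_has_integral_lebesgue') auto
  moreover have "(\<integral>\<^sup>+t\<in>{0<..<1}. ennreal (t powr (- a)) \<partial>lborel) \<le> (\<integral>\<^sup>+t. ennreal (t powr (- a)) * indicator {0..1} t \<partial>lborel)"
    by (intro nn_integral_mono) (auto simp: indicator_def)
  ultimately show ?thesis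
    by (metis ennreal_less_top le_less_trans)
qed

text \<open>
  Interpolation between the supremum and the total mass: \<open>k powr r\<close> is at most \<open>k\<close> times the
  \<open>(r - 1)\<close>-st power of the supremum.
\<close>

lemma kernel_powr_integral_le:
  fixes k :: "real \<Rightarrow> real"
  assumes [measurable]: "k \<in> borel_measurable borel" and "\<And>x. 0 \<le> k x" "\<And>x. k x \<le> t powr (-1/2)"
    and "(\<integral>\<^sup>+x. ennreal (k x) \<partial>lborel) \<le> 1" and "1 < r" "0 < t"
  shows "(\<integral>\<^sup>+x. ennpowr (ennreal (k x)) r \<partial>lborel) \<le> ennreal (t powr (- ((r - 1) / 2)))"
proof -
  have "ennpowr (ennreal (k x)) r \<le> ennreal (t powr (- ((r - 1) / 2))) * ennreal (k x)" for x
  proof -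
    have "k x powr r = k x powr (r - 1) * k x"
      using assms(2)[of x] by (cases "k x = 0") (auto simp: powr_diff)
    also have "\<dots> \<le> (t powr (-1/2)) powr (r - 1) * k x"
      using assms by (intro mult_right_mono powr_mono2) auto
    also have "(t powr (-1/2)) powr (r - 1) = t powr (- ((r - 1) / 2))"
      by (simp add: powr_powr algebra_simps)
    finally show ?thesis
      using assms(2)[of x] by (simp add: ennreal_mult[symmetric])
  qed
  then have "(\<integral>\<^sup>+x. ennpowr (ennreal (k x)) r \<partial>lborel) \<le> (\<integral>\<^sup>+x. ennreal (t powr (- ((r - 1) / 2))) * ennreal (k x) \<partial>lborel)"
    by (intro nn_integral_mono)
  also have "\<dots> = ennreal (t powr (- ((r - 1) / 2))) * (\<integral>\<^sup>+x. ennreal (k x) \<partial>lborel)"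
    by (intro nn_integral_cmult) auto
  also have "\<dots> \<le> ennreal (t powr (- ((r - 1) / 2))) * 1"
    by (intro mult_left_mono assms) auto
  finally show ?thesis by simp
qed

text \<open>
  A kernel with the size of a heat kernel lies in the dual mixed-norm space. If \<open>q \<le> p\<close>, Hoelder in
  \<open>x\<close> leaves \<open>t powr (- 1 / (2 * p))\<close>, whose power \<open>q'\<close> is integrable on \<open>(0,1)\<close> because
  admissibility means \<open>q' \<le> p\<close>. If \<open>p < q\<close>, then admissibility forces \<open>q > 2\<close>, hence \<open>q' < 2\<close>, and
  \<open>A x\<close>, the integral of \<open>K powr q'\<close> in \<open>t\<close>, is bounded uniformly in \<open>x\<close> as well as integrable in \<open>x\<close>;
  interpolating once more controls its power \<open>p' / q' > 1\<close>.
\<close>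

lemma kernel_pairing_bounded:
  fixes K :: "real \<times> real \<Rightarrow> real" and p q :: real
  assumes pq: "1 < p" "1 < q" "1 / p + 1 / q \<le> 1"
    and [measurable]: "K \<in> borel_measurable borel" and K0: "\<And>z. 0 \<le> K z"
    and K1: "\<And>t x. 0 < t \<Longrightarrow> t < 1 \<Longrightarrow> K (t, x) \<le> t powr (-1/2)"
    and K2: "\<And>t. 0 < t \<Longrightarrow> t < 1 \<Longrightarrow> (\<integral>\<^sup>+x. ennreal (K (t, x)) \<partial>lborel) \<le> 1"
  shows "\<exists>C<top. \<forall>e\<in>borel_measurable borel.
    (\<integral>\<^sup>+t\<in>{0<..<1}. (\<integral>\<^sup>+x. ennreal (K (t, x) * \<bar>e (t, x)\<bar>) \<partial>lborel) \<partial>lborel) \<le> C * Lpq_norm p q e"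
proof -
  define p' where "p' = p / (p - 1)"
  define q' where "q' = q / (q - 1)"
  have p': "1 < p'" "1/p' + 1/p = 1" and q': "1 < q'" "1/q' + 1/q = 1"
    using pq by (auto simp: p'_def q'_def field_simps)
  have Kint: "(\<integral>\<^sup>+x. ennpowr (ennreal (K (t, x))) r \<partial>lborel) \<le> ennreal (t powr (- ((r - 1) / 2)))"
    if "0 < t" "t < 1" "1 < r" for t r
    using that K0 K1 K2 by (intro kernel_powr_integral_le) (auto simp: borel_prod[symmetric])
  show ?thesis
  proof (cases "q \<le> p")
    case True
    define a where "a = q' / (2 * p)"
    have "1 / p \<le> 1 / q'" using pq(3) q'(2) by linarith
    then have "q' \<le> p" using pq q' by (simp add: field_simps)
    then have a: "a < 1" using pq q' by (simp add: a_def field_simps)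
    define C where "C = ennpowr (\<integral>\<^sup>+t\<in>{0<..<1}. ennreal (t powr (- a)) \<partial>lborel) (1/q')"
    have "C < top" unfolding C_def using nn_integral_powr_01_finite[OF a] by simp
    moreover have "(\<integral>\<^sup>+t\<in>{0<..<1}. (\<integral>\<^sup>+x. ennreal (K (t, x) * \<bar>e (t, x)\<bar>) \<partial>lborel) \<partial>lborel) \<le> C * Lpq_norm p q e"
      if e[measurable]: "e \<in> borel_measurable borel" for e :: "real \<times> real \<Rightarrow> real"
    proof -
      have [measurable]: "e \<in> borel_measurable (borel \<Otimes>\<^sub>M borel)" "K \<in> borel_measurable (borel \<Otimes>\<^sub>M borel)"
        by (auto simp: borel_prod)
      define E where "E t = (\<integral>\<^sup>+x. ennreal (\<bar>e (t, x)\<bar> powr p) \<partial>lborel)" for t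
      have [measurable]: "E \<in> borel_measurable borel"
        unfolding E_def by measurable
      have "(\<integral>\<^sup>+x. ennreal (K (t, x) * \<bar>e (t, x)\<bar>) \<partial>lborel) * indicator {0<..<1} t
          \<le> (ennreal (t powr (-1/(2*p))) * indicator {0<..<1} t) * (ennpowr (E t) (1/p) * indicator {0<..<1} t)" for t
      proof (cases "t \<in> {0<..<1}")
        case True
        have "(\<integral>\<^sup>+x. ennreal (K (t, x) * \<bar>e (t, x)\<bar>) \<partial>lborel) = (\<integral>\<^sup>+x. ennreal (K (t, x)) * ennreal \<bar>e (t, x)\<bar> \<partial>lborel)"
          using K0 by (simp add: ennreal_mult)
        also have "\<dots> \<le> ennpowr (\<integral>\<^sup>+x. ennpowr (ennreal (K (t, x))) p' \<partial>lborel) (1/p')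
           * ennpowr (\<integral>\<^sup>+x. ennpowr (ennreal \<bar>e (t, x)\<bar>) p \<partial>lborel) (1/p)"
          by (rule nn_integral_Holder[OF p'(1) pq(1) p'(2)]) measurable
        also have "(\<integral>\<^sup>+x. ennpowr (ennreal \<bar>e (t, x)\<bar>) p \<partial>lborel) = E t"
          by (simp add: E_def)
        also have "ennpowr (\<integral>\<^sup>+x. ennpowr (ennreal (K (t, x))) p' \<partial>lborel) (1/p')
            \<le> ennpowr (ennreal (t powr (- ((p' - 1) / 2)))) (1/p')"
          using True p' by (intro ennpowr_mono Kint) auto
        also have "\<dots> = ennreal (t powr (-1/(2*p)))"
        proof -
          have "- ((p' - 1) / 2) * (1/p') = -1/(2*p)"
            using pq by (simp add: p'_def field_simps)
          then show ?thesis using True by (simp add: powr_powr)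
        qed
        finally show ?thesis using True by (simp add: mult_right_mono)
      qed simp
      then have "(\<integral>\<^sup>+t\<in>{0<..<1}. (\<integral>\<^sup>+x. ennreal (K (t, x) * \<bar>e (t, x)\<bar>) \<partial>lborel) \<partial>lborel)
         \<le> (\<integral>\<^sup>+t. (ennreal (t powr (-1/(2*p))) * indicator {0<..<1} t) * (ennpowr (E t) (1/p) * indicator {0<..<1} t) \<partial>lborel)"
        by (intro nn_integral_mono)
      also have "\<dots> \<le> ennpowr (\<integral>\<^sup>+t. ennpowr (ennreal (t powr (-1/(2*p))) * indicator {0<..<1} t) q' \<partial>lborel) (1/q')
          * ennpowr (\<integral>\<^sup>+t. ennpowr (ennpowr (E t) (1/p) * indicator {0<..<1} t) q \<partial>lborel) (1/q)"
        by (rule nn_integral_Holder[OF q'(1) pq(2) q'(2)]) measurable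
      also have "\<dots> = C * ennpowr (\<integral>\<^sup>+t. ennpowr (E t) (q/p) * indicator {0<..<1} t \<partial>lborel) (1/q)"
        by (simp add: ennpowr_mult_indicator ennpowr_ennpowr C_def a_def powr_powr)
      also have "\<dots> = C * Lpq_norm p q e"
        using True by (simp add: Lpq_norm_def E_def nn_integral_completion)
      finally show ?thesis .
    qed
    ultimately show ?thesis by blast
  next
    case False
    then have pq': "p < q" by simp
    have "1/q < 1/p" using pq' pq by (simp add: field_simps)
    then have q2: "1/2 < 1/q'" using q'(2) pq(3) by linarith
    then have q2: "q' < 2" using q' by (simp add: field_simps)
    have "1/p' < 1/q'" using \<open>1/q < 1/p\<close> p'(2) q'(2) by linarith
    then have qp': "q' < p'" using p' q' by (simp add: field_simps)
    define r where "r = p' / q'"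
    have r: "1 < r" using qp' q' by (simp add: r_def)
    define B where "B = (\<integral>\<^sup>+t\<in>{0<..<1}. ennreal (t powr (- (q'/2))) \<partial>lborel)"
    define B2 where "B2 = (\<integral>\<^sup>+t\<in>{0<..<1}. ennreal (t powr (- ((q'-1)/2))) \<partial>lborel)"
    have B: "B < top" "B2 < top"
      unfolding B_def B2_def using q2 by (auto intro!: nn_integral_powr_01_finite)
    define C where "C = ennpowr (ennpowr B (r - 1) * B2) (1/p')"
    have "C < top" unfolding C_def using B by (simp add: ennreal_mult_less_top)
    define A where "A x = (\<integral>\<^sup>+t. ennpowr (ennreal (K (t, x)) * indicator {0<..<1} t) q' \<partial>lborel)" for x
    have KM[measurable]: "K \<in> borel_measurable (borel \<Otimes>\<^sub>M borel)"
      by (auto simp: borel_prod)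
    have [measurable]: "A \<in> borel_measurable borel"
      unfolding A_def by measurable
    have AB: "A x \<le> B" for x
      unfolding A_def B_def
    proof (intro nn_integral_mono)
      fix t :: real
      show "ennpowr (ennreal (K (t, x)) * indicator {0<..<1} t) q' \<le> ennreal (t powr (- (q'/2))) * indicator {0<..<1} t"
      proof (cases "t \<in> {0<..<1}")
        case True
        then have "K (t, x) powr q' \<le> (t powr (-1/2)) powr q'"
          using K0 K1 q' by (intro powr_mono2) auto
        then show ?thesis using True K0 by (simp add: powr_powr)
      qed simp
    qed
    have IA: "(\<integral>\<^sup>+x. A x \<partial>lborel) \<le> B2"
    proof -
      have "(\<integral>\<^sup>+x. A x \<partial>lborel) = (\<integral>\<^sup>+t. (\<integral>\<^sup>+x. ennpowr (ennreal (K (t, x)) * indicator {0<..<1} t) q' \<partial>lborel) \<partial>lborel)"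
        unfolding A_def by (intro lborel_pair.Fubini') measurable
      also have "\<dots> \<le> B2"
        unfolding B2_def
      proof (intro nn_integral_mono)
        fix t :: real
        show "(\<integral>\<^sup>+x. ennpowr (ennreal (K (t, x)) * indicator {0<..<1} t) q' \<partial>lborel) \<le> ennreal (t powr (- ((q'-1)/2))) * indicator {0<..<1} t"
          using Kint[of t q'] q' by (cases "t \<in> {0<..<1}") auto
      qed
      finally show ?thesis .
    qed
    have IA': "(\<integral>\<^sup>+x. ennpowr (A x) r \<partial>lborel) \<le> ennpowr B (r - 1) * B2"
    proof -
      have "ennpowr (A x) r \<le> ennpowr B (r - 1) * A x" for x
      proof -
        have "ennpowr (A x) r = ennpowr (A x) (r - 1) * A x"
          using ennpowr_add[of "A x" "r - 1" 1] by simp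
        also have "\<dots> \<le> ennpowr B (r - 1) * A x"
          using r AB by (intro mult_right_mono ennpowr_mono) auto
        finally show ?thesis .
      qed
      then have "(\<integral>\<^sup>+x. ennpowr (A x) r \<partial>lborel) \<le> (\<integral>\<^sup>+x. ennpowr B (r - 1) * A x \<partial>lborel)"
        by (intro nn_integral_mono)
      also have "\<dots> = ennpowr B (r - 1) * (\<integral>\<^sup>+x. A x \<partial>lborel)"
        by (intro nn_integral_cmult) measurable
      also have "\<dots> \<le> ennpowr B (r - 1) * B2"
        by (intro mult_left_mono IA) auto
      finally show ?thesis .
    qed
    have "(\<integral>\<^sup>+t\<in>{0<..<1}. (\<integral>\<^sup>+x. ennreal (K (t, x) * \<bar>e (t, x)\<bar>) \<partial>lborel) \<partial>lborel) \<le> C * Lpq_norm p q e"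
      if e[measurable]: "e \<in> borel_measurable borel" for e :: "real \<times> real \<Rightarrow> real"
    proof -
      have [measurable]: "e \<in> borel_measurable (borel \<Otimes>\<^sub>M borel)"
        by (auto simp: borel_prod)
      define E where "E x = (\<integral>\<^sup>+t\<in>{0<..<1}. ennreal (\<bar>e (t, x)\<bar> powr q) \<partial>lborel)" for x
      have [measurable]: "E \<in> borel_measurable borel"
        unfolding E_def by measurable
      have "(\<integral>\<^sup>+t\<in>{0<..<1}. (\<integral>\<^sup>+x. ennreal (K (t, x) * \<bar>e (t, x)\<bar>) \<partial>lborel) \<partial>lborel)
         = (\<integral>\<^sup>+t. (\<integral>\<^sup>+x. (ennreal (K (t, x)) * indicator {0<..<1} t) * (ennreal \<bar>e (t, x)\<bar> * indicator {0<..<1} t) \<partial>lborel) \<partial>lborel)"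
        using K0 by (intro nn_integral_cong) (auto simp: ennreal_mult indicator_def)
      also have "\<dots> = (\<integral>\<^sup>+x. (\<integral>\<^sup>+t. (ennreal (K (t, x)) * indicator {0<..<1} t) * (ennreal \<bar>e (t, x)\<bar> * indicator {0<..<1} t) \<partial>lborel) \<partial>lborel)"
        by (intro lborel_pair.Fubini'[symmetric]) measurable
      also have "\<dots> \<le> (\<integral>\<^sup>+x. ennpowr (A x) (1/q') * ennpowr (E x) (1/q) \<partial>lborel)"
      proof (intro nn_integral_mono)
        fix x :: real
        have "(\<integral>\<^sup>+t. (ennreal (K (t, x)) * indicator {0<..<1} t) * (ennreal \<bar>e (t, x)\<bar> * indicator {0<..<1} t) \<partial>lborel)
          \<le> ennpowr (A x) (1/q') * ennpowr (\<integral>\<^sup>+t. ennpowr (ennreal \<bar>e (t, x)\<bar> * indicator {0<..<1} t) q \<partial>lborel) (1/q)"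
          unfolding A_def by (rule nn_integral_Holder[OF q'(1) pq(2) q'(2)]) measurable
        also have "(\<integral>\<^sup>+t. ennpowr (ennreal \<bar>e (t, x)\<bar> * indicator {0<..<1} t) q \<partial>lborel) = E x"
          by (simp add: E_def ennpowr_mult_indicator)
        finally show "(\<integral>\<^sup>+t. (ennreal (K (t, x)) * indicator {0<..<1} t) * (ennreal \<bar>e (t, x)\<bar> * indicator {0<..<1} t) \<partial>lborel)
          \<le> ennpowr (A x) (1/q') * ennpowr (E x) (1/q)" .
      qed
      also have "\<dots> \<le> ennpowr (\<integral>\<^sup>+x. ennpowr (ennpowr (A x) (1/q')) p' \<partial>lborel) (1/p')
            * ennpowr (\<integral>\<^sup>+x. ennpowr (ennpowr (E x) (1/q)) p \<partial>lborel) (1/p)"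
        by (rule nn_integral_Holder[OF p'(1) pq(1) p'(2)]) measurable
      also have "\<dots> = ennpowr (\<integral>\<^sup>+x. ennpowr (A x) r \<partial>lborel) (1/p') * Lpq_norm p q e"
        using False by (simp add: Lpq_norm_def E_def nn_integral_completion ennpowr_ennpowr r_def)
      also have "\<dots> \<le> C * Lpq_norm p q e"
        unfolding C_def using p' by (intro mult_right_mono ennpowr_mono IA') auto
      finally show ?thesis .
    qed
    then show ?thesis using \<open>C < top\<close> by blast
  qed
qed


section \<open>Parabolic duality\<close>

text \<open>
  Green's identity for the forward equation solved by \<open>g\<close> and the backward operator applied to \<open>z\<close>.
  The integrand on the left is \<open>\<partial>\<^sub>t (g z)\<close> minus the space derivative of the flux
  \<open>gx z / 2 - g zx / 2 - b g z\<close>. The flux vanishes on the lateral boundary, where \<open>z\<close> vanishes to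
  first order, so that only the initial time contributes.
\<close>

lemma parabolic_duality:
  fixes g gt gx gxx z zt zx zxx :: "real \<times> real \<Rightarrow> real" and b :: "real \<Rightarrow> real" and t0 t1 x0 x1 :: real
  defines "Q \<equiv> {t0..t1} \<times> {x0..x1}"
  assumes le: "t0 \<le> t1" "x0 \<le> x1"
    and cont: "continuous_on Q g" "continuous_on Q gt" "continuous_on Q z" "continuous_on Q zt" 
    and g_deriv:
      "\<And>t x. (t, x) \<in> Q \<Longrightarrow> ((\<lambda>s. g (s, x)) has_real_derivative gt (t, x)) (at t within {t0..t1})"
      "\<And>t x. (t, x) \<in> Q \<Longrightarrow> ((\<lambda>y. g (t, y)) has_real_derivative gx (t, x)) (at x within {x0..x1})"
      "\<And>t x. (t, x) \<in> Q \<Longrightarrow> ((\<lambda>y. gx (t, y)) has_real_derivative gxx (t, x)) (at x within {x0..x1})"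
    and z_deriv:
      "\<And>t x. (t, x) \<in> Q \<Longrightarrow> ((\<lambda>s. z (s, x)) has_real_derivative zt (t, x)) (at t within {t0..t1})"
      "\<And>t x. (t, x) \<in> Q \<Longrightarrow> ((\<lambda>y. z (t, y)) has_real_derivative zx (t, x)) (at x within {x0..x1})"
      "\<And>t x. (t, x) \<in> Q \<Longrightarrow> ((\<lambda>y. zx (t, y)) has_real_derivative zxx (t, x)) (at x within {x0..x1})"
    and forward: "\<And>t x. (t, x) \<in> Q \<Longrightarrow> gt (t, x) = 1/2 * gxx (t, x) - b t * gx (t, x)"
    and z_final: "\<And>x. x \<in> {x0..x1} \<Longrightarrow> z (t1, x) = 0"
    and z_lateral: "\<And>t x. t \<in> {t0..t1} \<Longrightarrow> x = x0 \<or> x = x1 \<Longrightarrow> z (t, x) = 0 \<and> zx (t, x) = 0"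
  shows "integral {t0..t1} (\<lambda>t. integral {x0..x1} (\<lambda>x. g (t, x) * (zt (t, x) + 1/2 * zxx (t, x) + b t * zx (t, x))))
    = - integral {x0..x1} (\<lambda>x. g (t0, x) * z (t0, x))"
proof -
  define T where "T z' = gt z' * z z' + g z' * zt z'" for z'
  have contT: "continuous_on Q T"
    unfolding T_def by (intro continuous_intros cont)
  \<comment> \<open>Fix \<open>t\<close>: the flux \<open>J\<close> contributes nothing.\<close>
  have inner: "integral {x0..x1} (\<lambda>x. g (t, x) * (zt (t, x) + 1/2 * zxx (t, x) + b t * zx (t, x)))
      = integral {x0..x1} (\<lambda>x. T (t, x))" if t: "t \<in> {t0..t1}" for t
  proof -
    define J where "J x = 1/2 * gx (t, x) * z (t, x) - 1/2 * g (t, x) * zx (t, x) - b t * g (t, x) * z (t, x)" for x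
    define J' where "J' x = 1/2 * gxx (t, x) * z (t, x) - 1/2 * g (t, x) * zxx (t, x)
       - b t * gx (t, x) * z (t, x) - b t * g (t, x) * zx (t, x)" for x
    have "(J has_real_derivative J' x) (at x within {x0..x1})" if x: "x \<in> {x0..x1}" for x
    proof -
      have Q: "(t, x) \<in> Q" using t x by (simp add: Q_def)
      show ?thesis
        unfolding J_def J'_def
        by (rule derivative_eq_intros g_deriv[OF Q] z_deriv[OF Q] refl)+ (simp add: algebra_simps)
    qed
    then have "(J' has_integral (J x1 - J x0)) {x0..x1}"
      using le by (intro fundamental_theorem_of_calculus) (auto simp: has_real_derivative_iff_has_vector_derivative)
    then have J: "(J' has_integral 0) {x0..x1}"
      using z_lateral[OF t] by (simp add: J_def)
    have "continuous_on {x0..x1} (\<lambda>x. T (t, x))"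
      using t by (intro continuous_on_compose2[OF contT] continuous_intros) (auto simp: Q_def)
    then have "((\<lambda>x. T (t, x)) has_integral integral {x0..x1} (\<lambda>x. T (t, x))) {x0..x1}"
      by (intro integrable_integral integrable_continuous_real)
    from has_integral_diff[OF this J]
    have "((\<lambda>x. T (t, x) - J' x) has_integral integral {x0..x1} (\<lambda>x. T (t, x))) {x0..x1}" by simp
    then have "((\<lambda>x. g (t, x) * (zt (t, x) + 1/2 * zxx (t, x) + b t * zx (t, x))) has_integral integral {x0..x1} (\<lambda>x. T (t, x))) {x0..x1}"
    proof (rule has_integral_eq[rotated])
      fix x assume "x \<in> {x0..x1}"
      then have "(t, x) \<in> Q" using t by (simp add: Q_def)
      from forward[OF this] show "T (t, x) - J' x = g (t, x) * (zt (t, x) + 1/2 * zxx (t, x) + b t * zx (t, x))"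
        by (simp add: T_def J'_def) (simp add: algebra_simps)
    qed
    then show ?thesis by (rule integral_unique)
  qed
  \<comment> \<open>Fix \<open>x\<close>: only the initial value of \<open>g z\<close> survives.\<close>
  have outer: "integral {t0..t1} (\<lambda>t. T (t, x)) = - (g (t0, x) * z (t0, x))" if x: "x \<in> {x0..x1}" for x
  proof -
    have "((\<lambda>s. g (s, x) * z (s, x)) has_real_derivative T (t, x)) (at t within {t0..t1})" if t: "t \<in> {t0..t1}" for t
    proof -
      have Q: "(t, x) \<in> Q" using t x by (simp add: Q_def)
      show ?thesis
        unfolding T_def
        by (rule derivative_eq_intros g_deriv[OF Q] z_deriv[OF Q] refl)+ (simp add: algebra_simps)
    qed
    then have "((\<lambda>t. T (t, x)) has_integral (g (t1, x) * z (t1, x) - g (t0, x) * z (t0, x))) {t0..t1}"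
      using le by (intro fundamental_theorem_of_calculus) (auto simp: has_real_derivative_iff_has_vector_derivative)
    then show ?thesis using z_final[OF x] by (simp add: integral_unique)
  qed
  have "integral {t0..t1} (\<lambda>t. integral {x0..x1} (\<lambda>x. g (t, x) * (zt (t, x) + 1/2 * zxx (t, x) + b t * zx (t, x))))
      = integral {t0..t1} (\<lambda>t. integral {x0..x1} (\<lambda>x. T (t, x)))"
    using inner by (rule integral_cong)
  also have "\<dots> = integral {x0..x1} (\<lambda>x. integral {t0..t1} (\<lambda>t. T (t, x)))"
  proof -
    have "continuous_on (cbox (t0, x0) (t1, x1)) (\<lambda>(t, x). T (t, x))"
      using contT by (simp add: Q_def cbox_Pair_eq)
    from integral_swap_continuous[OF this] show ?thesis by simp
  qed
  also have "\<dots> = integral {x0..x1} (\<lambda>x. - (g (t0, x) * z (t0, x)))"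
    using outer by (rule integral_cong)
  finally show ?thesis by simp
qed

section \<open>A smooth convex substitute for the positive part\<close>

text \<open>
  A function of \<open>max 0 x\<close> inherits differentiability at \<open>0\<close> because the two one-sided
  derivatives there are \<open>0\<close> and \<open>F' 0\<close>, which agree.
\<close>

lemma DERIV_compose_max_0:
  fixes F F' :: "real \<Rightarrow> real"
  assumes F: "\<And>x. (F has_real_derivative F' x) (at x)" and "F' 0 = 0"
  shows "((\<lambda>x. F (max 0 x)) has_real_derivative F' (max 0 x)) (at x)"
proof -
  consider "x < 0" | "x = 0" | "x > 0" by linarith
  then show ?thesis
  proof cases
    case 1
    have "((\<lambda>x. F (max 0 x)) has_real_derivative 0) (at x)"
      by (rule has_field_derivative_transform_within_open[where f = "\<lambda>_. F 0" and S = "{..<0}"]) (use 1 in auto)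
    then show ?thesis using 1 assms by simp
  next
    case 3
    have "((\<lambda>x. F (max 0 x)) has_real_derivative F' x) (at x)"
      by (rule has_field_derivative_transform_within_open[where f = F and S = "{0<..}"]) (use 3 F in auto)
    then show ?thesis using 3 by simp
  next
    case 2
    have "(\<lambda>h. (F (0 + h) - F 0) / h) \<midarrow>0\<rightarrow> 0"
      using F[of 0] assms(2) by (simp add: DERIV_def)
    then have "(\<lambda>h. (F (max 0 (0 + h)) - F (max 0 0)) / h) \<midarrow>0\<rightarrow> 0"
      by (rule Lim_null_comparison[rotated, OF tendsto_norm_zero]) (auto intro!: always_eventually simp: max_def divide_nonneg_neg)
    then show ?thesis using 2 assms(2) by (simp add: DERIV_def)
  qed
qed

text \<open>
  A \<open>C\<^sup>2\<close>, convex function that vanishes on the negative axis and has slope at most \<open>1\<close>. Convexity makes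
  composition with it preserve subsolutions, and the slope bound keeps constants independent of the
  function it is composed with; the positive part has both properties but is not smooth.
  \<open>ramp1\<close> and \<open>ramp2\<close> are its first two derivatives.
\<close>

definition ramp :: "real \<Rightarrow> real" where "ramp s = max 0 s - arctan (max 0 s)"
definition ramp1 :: "real \<Rightarrow> real" where "ramp1 s = (max 0 s)\<^sup>2 / (1 + (max 0 s)\<^sup>2)"
definition ramp2 :: "real \<Rightarrow> real" where "ramp2 s = 2 * max 0 s / (1 + (max 0 s)\<^sup>2)\<^sup>2"

lemma one_plus_square_neq_0 [simp]: "1 + (x::real)\<^sup>2 \<noteq> 0"
  by (metis add_pos_nonneg less_irrefl zero_le_power2 zero_less_one)

lemma one_plus_mult_self_neq_0 [simp]: "1 + (x::real) * x \<noteq> 0"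
  using one_plus_square_neq_0[of x] by (simp add: power2_eq_square)

lemma DERIV_ramp: "(ramp has_real_derivative ramp1 s) (at s)"
  unfolding ramp_def ramp1_def
  by (rule DERIV_compose_max_0[where F = "\<lambda>m. m - arctan m" and F' = "\<lambda>m. m\<^sup>2 / (1 + m\<^sup>2)"])
    (auto intro!: derivative_eq_intros simp: field_simps)

lemma DERIV_ramp1: "(ramp1 has_real_derivative ramp2 s) (at s)"
  unfolding ramp1_def ramp2_def
  by (rule DERIV_compose_max_0[where F = "\<lambda>m. m\<^sup>2 / (1 + m\<^sup>2)" and F' = "\<lambda>m. 2 * m / (1 + m\<^sup>2)\<^sup>2"])
    (auto intro!: derivative_eq_intros simp: field_simps power2_eq_square)

lemma ramp1_bounds: "0 \<le> ramp1 s" "ramp1 s \<le> 1" and ramp2_nonneg: "0 \<le> ramp2 s"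
  unfolding ramp1_def ramp2_def by (auto simp: divide_le_eq_1 add_pos_nonneg)

lemma ramp_nonpos: "s \<le> 0 \<Longrightarrow> ramp s = 0" "s \<le> 0 \<Longrightarrow> ramp1 s = 0"
  by (auto simp: ramp_def ramp1_def max_def)

lemma ramp_continuous: "continuous_on S ramp" "continuous_on S ramp1" "continuous_on S ramp2"
  using DERIV_ramp DERIV_ramp1
proof -
  show "continuous_on S ramp"
    by (rule DERIV_continuous_on[OF has_field_derivative_at_within[OF DERIV_ramp]])
  show "continuous_on S ramp1"
    by (rule DERIV_continuous_on[OF has_field_derivative_at_within[OF DERIV_ramp1]])
  show "continuous_on S ramp2"
    unfolding ramp2_def by (intro continuous_intros) simp
qed

lemma ramp_mono: "s \<le> s' \<Longrightarrow> ramp s \<le> ramp s'"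
  using DERIV_ramp ramp1_bounds by (metis DERIV_nonneg_imp_nondecreasing)

lemma ramp_pos: "0 < s \<Longrightarrow> 0 < ramp s"
  using DERIV_pos_imp_increasing_open[of 0 s ramp] DERIV_ramp ramp_continuous(1)
  by (fastforce simp: ramp_nonpos ramp1_def add_pos_nonneg)

lemma ramp_nonneg: "0 \<le> ramp s"
  using ramp_mono[of "min 0 s" s] ramp_nonpos(1)[of "min 0 s"] by simp


section \<open>The Gaussian density carried along the front\<close>

text \<open>
  The position at time \<open>t\<close> of a particle that leaves the origin along the drift to the right. Since
  \<open>\<nu> > 1/2\<close>, it is much larger than the diffusive scale \<open>sqrt t\<close> as \<open>t\<close> tends to \<open>0\<close>.
\<close>

definition front :: "real \<Rightarrow> real \<Rightarrow> real"
  where "front \<nu> t = t powr (1 - \<nu>) / (1 - \<nu>)"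

lemma DERIV_front:
  assumes "\<nu> < 1" "0 < t"
  shows "(front \<nu> has_real_derivative t powr (- \<nu>)) (at t)"
  unfolding front_def
  using DERIV_cdivide[OF has_real_derivative_powr[OF assms(2), of "1 - \<nu>"], of "1 - \<nu>"] assms by simp

text \<open>
  The transition density, started from the origin at time \<open>0\<close>, of Brownian motion with the drift
  \<open>t powr (- \<nu>)\<close> on the whole line, that is, without the change of sign at \<open>x = 0\<close>. The next three
  functions are its partial derivatives.
\<close>

definition front_density :: "real \<Rightarrow> real \<times> real \<Rightarrow> real"
  where "front_density \<nu> = (\<lambda>(t, x). normal_density (front \<nu> t) (sqrt t) x)"

definition front_density_t :: "real \<Rightarrow> real \<times> real \<Rightarrow> real"
  where "front_density_t \<nu> = (\<lambda>(t, x). front_density \<nu> (t, x) *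
    ((x - front \<nu> t) * t powr (- \<nu>) / t + (x - front \<nu> t)\<^sup>2 / (2 * t\<^sup>2) - 1 / (2 * t)))"

definition front_density_x :: "real \<Rightarrow> real \<times> real \<Rightarrow> real"
  where "front_density_x \<nu> = (\<lambda>(t, x). - (front_density \<nu> (t, x) * ((x - front \<nu> t) / t)))"

definition front_density_xx :: "real \<Rightarrow> real \<times> real \<Rightarrow> real"
  where "front_density_xx \<nu> = (\<lambda>(t, x). front_density \<nu> (t, x) * ((x - front \<nu> t)\<^sup>2 / t\<^sup>2 - 1 / t))"

lemma front_density_eq: "0 < t \<Longrightarrow> front_density \<nu> (t, x) = exp (- (x - front \<nu> t)\<^sup>2 / (2 * t)) / sqrt (2 * pi * t)"
  by (simp add: front_density_def normal_density_def)

lemma front_density_nonneg: "0 \<le> front_density \<nu> z"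
  by (simp add: front_density_def split_beta)

lemma front_density_measurable [measurable]: "front_density \<nu> \<in> borel_measurable borel"
proof -
  have "front_density \<nu> \<in> borel_measurable (borel \<Otimes>\<^sub>M borel)"
    unfolding front_density_def normal_density_def front_def by measurable
  then show ?thesis by (simp add: borel_prod)
qed

lemma front_density_le:
  assumes "0 < t" shows "front_density \<nu> (t, x) \<le> t powr (-1/2)"
proof -
  have "front_density \<nu> (t, x) \<le> 1 / sqrt (2 * pi * t)"
    unfolding front_density_eq[OF assms] using assms by (intro divide_right_mono) auto
  also have "\<dots> \<le> 1 / sqrt t"
    using assms pi_gt3 by (intro divide_left_mono real_sqrt_le_mono) auto
  also have "\<dots> = t powr (-1/2)"
    using assms by (simp add: powr_minus_divide powr_half_sqrt[symmetric])
  finally show ?thesis .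
qed

lemma nn_integral_front_density:
  assumes "0 < t" shows "(\<integral>\<^sup>+x. ennreal (front_density \<nu> (t, x)) \<partial>lborel) = 1"
  using assms by (simp add: front_density_def nn_integral_eq_integral normal_density_nonneg)

lemma DERIV_front_density_t:
  assumes "\<nu> < 1" "0 < t"
  shows "((\<lambda>s. front_density \<nu> (s, x)) has_real_derivative front_density_t \<nu> (t, x)) (at t)"
proof -
  define E where "E s = exp (- (x - front \<nu> s)\<^sup>2 / (2 * s))" for s
  define S where "S s = sqrt (2 * pi * s)" for s
  define A where "A = (x - front \<nu> t) * t powr (- \<nu>) / t + (x - front \<nu> t)\<^sup>2 / (2 * t\<^sup>2)"
  have "((\<lambda>s. - (x - front \<nu> s)\<^sup>2 / (2 * s)) has_real_derivative A) (at t)"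
    using assms unfolding A_def
    by (auto intro!: derivative_eq_intros DERIV_front simp: field_simps power2_eq_square)
  from DERIV_fun_exp[OF this] have dE: "(E has_real_derivative E t * A) (at t)"
    unfolding E_def .
  have St: "0 < S t" "S t * S t = 2 * pi * t"
    using assms by (auto simp: S_def)
  have "(S has_real_derivative 2 * pi * (inverse (S t) / 2)) (at t)"
    unfolding S_def using assms by (auto intro!: derivative_eq_intros simp: mult_less_0_iff)
  also have "2 * pi * (inverse (S t) / 2) = S t / (2 * t)"
    using St assms by (simp add: field_simps)
  finally have dS: "(S has_real_derivative S t / (2 * t)) (at t)" .
  have "((\<lambda>s. E s / S s) has_real_derivative (E t * A * S t - E t * (S t / (2 * t))) / (S t * S t)) (at t)"
    using dE dS St by (intro DERIV_divide) auto
  also have "(E t * A * S t - E t * (S t / (2 * t))) / (S t * S t) = E t / S t * (A - 1 / (2 * t))"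
    using St(1) assms by (simp add: field_simps)
  also have "\<dots> = front_density_t \<nu> (t, x)"
    using assms by (simp add: front_density_t_def front_density_eq E_def S_def A_def)
  finally show ?thesis
    by (rule has_field_derivative_transform_within_open[where S = "{0<..}"])
      (use assms front_density_eq in \<open>auto simp: E_def S_def\<close>)
qed

lemma DERIV_front_density_x:
  assumes "0 < t"
  shows "((\<lambda>y. front_density \<nu> (t, y)) has_real_derivative front_density_x \<nu> (t, x)) (at x)"
    "((\<lambda>y. front_density_x \<nu> (t, y)) has_real_derivative front_density_xx \<nu> (t, x)) (at x)"
proof -
  show *: "((\<lambda>y. front_density \<nu> (t, y)) has_real_derivative front_density_x \<nu> (t, x)) (at x)" for x
  proof -
    have "((\<lambda>y. - (y - front \<nu> t)\<^sup>2 / (2 * t)) has_real_derivative - ((x - front \<nu> t) / t)) (at x)"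
      using assms by (auto intro!: derivative_eq_intros simp: field_simps)
    from DERIV_cdivide[OF DERIV_fun_exp[OF this], of "sqrt (2 * pi * t)"]
    show ?thesis using assms by (simp add: front_density_x_def front_density_eq mult.commute)
  qed
  show "((\<lambda>y. front_density_x \<nu> (t, y)) has_real_derivative front_density_xx \<nu> (t, x)) (at x)"
    unfolding front_density_x_def front_density_xx_def prod.case using assms
    by (auto intro!: derivative_eq_intros * simp: front_density_x_def field_simps power2_eq_square)
qed

lemma front_density_forward_equation:
  "0 < t \<Longrightarrow> front_density_t \<nu> (t, x) = 1/2 * front_density_xx \<nu> (t, x) - t powr (- \<nu>) * front_density_x \<nu> (t, x)"
  by (simp add: front_density_t_def front_density_xx_def front_density_x_def field_simps)

lemma continuous_on_front_density:
  assumes "\<nu> < 1" "S \<subseteq> {0<..} \<times> UNIV"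
  shows "continuous_on S (front_density \<nu>)" "continuous_on S (front_density_t \<nu>)"
proof -
  have pos: "\<And>z. z \<in> S \<Longrightarrow> fst z > 0" using assms(2) by auto
  have ne: "fst z \<noteq> 0" if "z \<in> S" for z using pos[OF that] by simp
  show *: "continuous_on S (front_density \<nu>)"
    unfolding front_density_def front_def normal_density_def split_beta
    by (intro continuous_intros) (use pos ne assms(1) in \<open>auto simp: less_imp_le\<close>)
  show "continuous_on S (front_density_t \<nu>)"
    unfolding front_density_t_def front_def split_beta prod.collapse
    by (intro continuous_intros *) (use pos ne assms(1) in auto)
qed

section \<open>An explicit subsolution that jumps at the origin\<close>

text \<open>
  For a frozen time, \<open>1 - exp (- 2 * x * t powr (- \<nu>))\<close> is the probability that a particle at \<open>x > 0\<close>
  with constant drift \<open>t powr (- \<nu>)\<close> never hits \<open>0\<close>. Halving the exponent buys a positive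
  term of order \<open>t powr (- 2 * \<nu>)\<close> in the generator, which pays for letting \<open>t\<close> vary. The subtracted terms
  make the function nonpositive at \<open>t = 1\<close> and for large \<open>x\<close>; the quadratic one is centred at the front because
  a function of \<open>x - front \<nu> t\<close> does not feel the singular drift.
\<close>

definition barrier :: "real \<Rightarrow> real \<times> real \<Rightarrow> real"
  where "barrier \<nu> = (\<lambda>(t, x). 1 - exp (- (x * t powr (- \<nu>))) - t - (x - front \<nu> t)\<^sup>2)"

definition barrier_t :: "real \<Rightarrow> real \<times> real \<Rightarrow> real"
  where "barrier_t \<nu> = (\<lambda>(t, x). - (\<nu> * x * t powr (- \<nu> - 1) * exp (- (x * t powr (- \<nu>)))) - 1
    + 2 * (x - front \<nu> t) * t powr (- \<nu>))"

definition barrier_x :: "real \<Rightarrow> real \<times> real \<Rightarrow> real"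
  where "barrier_x \<nu> = (\<lambda>(t, x). t powr (- \<nu>) * exp (- (x * t powr (- \<nu>))) - 2 * (x - front \<nu> t))"

definition barrier_xx :: "real \<Rightarrow> real \<times> real \<Rightarrow> real"
  where "barrier_xx \<nu> = (\<lambda>(t, x). - ((t powr (- \<nu>))\<^sup>2 * exp (- (x * t powr (- \<nu>)))) - 2)"

lemma DERIV_barrier:
  assumes "\<nu> < 1" "0 < t"
  shows "((\<lambda>s. barrier \<nu> (s, x)) has_real_derivative barrier_t \<nu> (t, x)) (at t)"
    "((\<lambda>y. barrier \<nu> (t, y)) has_real_derivative barrier_x \<nu> (t, x)) (at x)"
    "((\<lambda>y. barrier_x \<nu> (t, y)) has_real_derivative barrier_xx \<nu> (t, x)) (at x)"
proof -
  note [derivative_intros] = DERIV_chain2[OF DERIV_front]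
  show "((\<lambda>s. barrier \<nu> (s, x)) has_real_derivative barrier_t \<nu> (t, x)) (at t)"
    unfolding barrier_def barrier_t_def prod.case using assms
    by (auto intro!: derivative_eq_intros simp: algebra_simps)
  show "((\<lambda>y. barrier \<nu> (t, y)) has_real_derivative barrier_x \<nu> (t, x)) (at x)"
    unfolding barrier_def barrier_x_def prod.case
    by (auto intro!: derivative_eq_intros simp: algebra_simps)
  show "((\<lambda>y. barrier_x \<nu> (t, y)) has_real_derivative barrier_xx \<nu> (t, x)) (at x)"
    unfolding barrier_x_def barrier_xx_def prod.case
    by (auto intro!: derivative_eq_intros simp: algebra_simps power2_eq_square)
qed

lemma continuous_on_barrier:
  assumes "\<nu> < 1" "S \<subseteq> {0<..} \<times> UNIV"
  shows "continuous_on S (barrier \<nu>)" "continuous_on S (barrier_t \<nu>)"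
    "continuous_on S (barrier_x \<nu>)" "continuous_on S (barrier_xx \<nu>)"
proof -
  have ne: "fst z \<noteq> 0" if "z \<in> S" for z using assms(2) that by auto
  show "continuous_on S (barrier \<nu>)" "continuous_on S (barrier_t \<nu>)"
    "continuous_on S (barrier_x \<nu>)" "continuous_on S (barrier_xx \<nu>)"
    unfolding barrier_def barrier_t_def barrier_x_def barrier_xx_def front_def split_beta
    by (intro continuous_intros; use ne assms(1) in auto)+
qed

lemma barrier_at_0: "0 < t \<Longrightarrow> barrier \<nu> (t, 0) \<le> 0"
  using zero_le_power2[of "0 - front \<nu> t"] unfolding barrier_def prod.case mult_zero_left minus_zero exp_zero
  by linarith

lemma barrier_final: "barrier \<nu> (1, x) \<le> 0"
proof -
  have "0 \<le> exp (- x)" "0 \<le> (x - front \<nu> 1)\<^sup>2" by auto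
  then show ?thesis unfolding barrier_def powr_one_eq_one prod.case mult_1_right by linarith
qed

lemma barrier_far:
  assumes "\<nu> < 1" "0 < t" "t \<le> 1" "1 + 1 / (1 - \<nu>) \<le> x"
  shows "barrier \<nu> (t, x) \<le> 0"
proof -
  have "front \<nu> t \<le> 1 / (1 - \<nu>)"
    unfolding front_def using assms by (intro divide_right_mono powr_le1) auto
  then have "1 \<le> (x - front \<nu> t)\<^sup>2" using assms by (intro one_le_power) auto
  moreover have "0 \<le> exp (- (x * t powr (- \<nu>)))" by simp
  ultimately show ?thesis unfolding barrier_def prod.case using assms(2) by argo
qed

text \<open>
  With \<open>s = x * t powr (- \<nu>)\<close>, the generator equals
  \<open>exp (- s) * (t powr (- 2 * \<nu>) / 2 - \<nu> * s / t) - 2\<close>. The bracket is negative only when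
  \<open>2 * \<nu> * s > t powr (1 - 2 * \<nu>)\<close>. As \<open>1 - 2 * \<nu> < 0\<close>, this bounds \<open>1 / t\<close> by a power of \<open>s\<close>, which \<open>exp (- s)\<close> absorbs.
\<close>

lemma generator_barrier_bounded_below:
  assumes "1/2 < \<nu>" "\<nu> < 1"
  obtains \<Psi> where "0 < \<Psi>" "\<And>t x. 0 < t \<Longrightarrow> t \<le> 1 \<Longrightarrow> 0 \<le> x \<Longrightarrow>
    - \<Psi> \<le> barrier_t \<nu> (t, x) + 1/2 * barrier_xx \<nu> (t, x) + t powr (- \<nu>) * barrier_x \<nu> (t, x)"
proof -
  define m where "m = 1 / (2 * \<nu> - 1)"
  obtain n :: nat where n: "m \<le> real n" using real_arch_simple by blast
  define K where "K = \<nu> * (2 * \<nu>) ^ n * fact (Suc n)"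
  have K0: "0 \<le> K" using assms by (simp add: K_def)
  have "- (K + 2) \<le> barrier_t \<nu> (t, x) + 1/2 * barrier_xx \<nu> (t, x) + t powr (- \<nu>) * barrier_x \<nu> (t, x)"
    if t: "0 < t" "t \<le> 1" and x: "0 \<le> x" for t x
  proof -
    define s where "s = x * t powr (- \<nu>)"
    have s0: "0 \<le> s" using x by (simp add: s_def)
    have eq: "barrier_t \<nu> (t, x) + 1/2 * barrier_xx \<nu> (t, x) + t powr (- \<nu>) * barrier_x \<nu> (t, x)
        = exp (- s) * (1/2 * (t powr (- \<nu>))\<^sup>2 - \<nu> * s / t) - 2"
      using t unfolding barrier_t_def barrier_xx_def barrier_x_def s_def prod.case
      by (simp add: powr_diff field_simps power2_eq_square)
    have "- K \<le> exp (- s) * (1/2 * (t powr (- \<nu>))\<^sup>2 - \<nu> * s / t)"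
    proof (cases "\<nu> * s / t \<le> 1/2 * (t powr (- \<nu>))\<^sup>2")
      case True
      then have "0 \<le> exp (- s) * (1/2 * (t powr (- \<nu>))\<^sup>2 - \<nu> * s / t)" by simp
      then show ?thesis using K0 by linarith
    next
      case False
      have pw: "t * (t powr (- \<nu>))\<^sup>2 = t powr (1 - 2 * \<nu>)"
        using t by (simp add: power2_eq_square powr_add[symmetric] powr_mult_base)
      have "1/2 * (t * (t powr (- \<nu>))\<^sup>2) < \<nu> * s"
        using False t by (simp add: field_simps)
      then have tv: "t powr (1 - 2 * \<nu>) \<le> 2 * \<nu> * s" unfolding pw by simp
      have "1 = 1 powr (1 - 2 * \<nu>)" by simp
      also have "\<dots> \<le> t powr (1 - 2 * \<nu>)"
        using t assms by (intro powr_mono2') auto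
      finally have v1: "1 \<le> 2 * \<nu> * s" using tv by simp
      have "1 / t = (t powr (1 - 2 * \<nu>)) powr m"
      proof -
        have "(1 - 2 * \<nu>) * m = -1" using assms by (simp add: m_def field_simps)
        then show ?thesis using t by (simp add: powr_powr powr_minus_divide)
      qed
      also have "\<dots> \<le> (2 * \<nu> * s) powr m"
        using tv assms by (intro powr_mono2) (auto simp: m_def)
      also have "\<dots> \<le> (2 * \<nu> * s) powr n"
        using n v1 by (intro powr_mono) auto
      also have "\<dots> = (2 * \<nu>) ^ n * s ^ n"
        using v1 by (subst powr_realpow) (auto simp: power_mult_distrib)
      finally have "\<nu> * s * (1 / t) \<le> \<nu> * s * ((2 * \<nu>) ^ n * s ^ n)"
        using s0 assms by (intro mult_left_mono) auto
      also have "\<dots> = \<nu> * (2 * \<nu>) ^ n * s ^ Suc n" by simp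
      also have "s ^ Suc n \<le> fact (Suc n) * exp s"
      proof -
        have "s ^ Suc n / fact (Suc n) \<le> exp s"
          using exp_converges[of s] s0 sum_le_suminf[of "\<lambda>k. s ^ k /\<^sub>R fact k" "{Suc n}"]
          by (simp add: sums_iff divide_inverse mult.commute)
        then show ?thesis by (simp add: divide_le_eq mult.commute del: fact_Suc power_Suc)
      qed
      finally have "\<nu> * s / t \<le> K * exp s"
        using assms by (simp add: K_def mult.assoc mult_left_mono)
      then have "exp (- s) * (\<nu> * s / t) \<le> exp (- s) * (K * exp s)"
        by (intro mult_left_mono) auto
      also have "\<dots> = K" by (simp add: exp_minus)
      finally have "exp (- s) * (\<nu> * s / t) \<le> K" .
      moreover have "0 \<le> exp (- s) * (1/2 * (t powr (- \<nu>))\<^sup>2)" by simp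
      ultimately show ?thesis unfolding right_diff_distrib by linarith
    qed
    then show ?thesis unfolding eq by linarith
  qed
  moreover have "0 < K + 2" using K0 by simp
  ultimately show ?thesis using that by blast
qed

text \<open>
  At distance at most \<open>sqrt t\<close> from the front, \<open>x * t powr (- \<nu>)\<close> is at least \<open>T\<^sup>2 / (1 - \<nu>) - T\<close> with
  \<open>T = t powr (1/2 - \<nu>)\<close>, and \<open>T\<close> tends to infinity as \<open>t\<close> tends to \<open>0\<close>.
\<close>

lemma barrier_near_front:
  assumes "1/2 < \<nu>" "\<nu> < 1"
  shows "\<exists>\<tau>>0. \<forall>t x. 0 < t \<and> t < \<tau> \<and> \<bar>x - front \<nu> t\<bar> \<le> sqrt t \<longrightarrow> 0 \<le> x \<and> 1/2 \<le> barrier \<nu> (t, x)"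
proof (intro exI conjI allI impI; (elim conjE)?)
  \<comment> \<open>The second bound on \<open>t\<close> means \<open>T \<ge> 3\<close>, which makes the exponent at least \<open>6\<close>.\<close>
  define \<tau> where "\<tau> = min (1/8) (3 powr (1 / (1/2 - \<nu>)))"
  show "0 < \<tau>" by (simp add: \<tau>_def)
  fix t x assume t: "0 < t" "t < \<tau>" and x: "\<bar>x - front \<nu> t\<bar> \<le> sqrt t"
  define T where "T = t powr (1/2 - \<nu>)"
  have "3 = (3 powr (1 / (1/2 - \<nu>))) powr (1/2 - \<nu>)"
    using assms by (simp add: powr_powr)
  also have "\<dots> \<le> T"
    unfolding T_def using t assms by (intro powr_mono2') (auto simp: \<tau>_def)
  finally have T: "3 \<le> T" .
  have sq: "sqrt t = t powr (1/2)" using t by (simp add: powr_half_sqrt)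
  have "T\<^sup>2 = t powr (1 - \<nu>) * t powr (- \<nu>)"
    using t by (simp add: T_def power2_eq_square powr_add[symmetric])
  then have fr: "front \<nu> t * t powr (- \<nu>) = T\<^sup>2 / (1 - \<nu>)"
    by (simp add: front_def)
  have "6 \<le> T * (T - 1)" using T mult_mono[of 3 T 2 "T - 1"] by simp
  also have "\<dots> = T\<^sup>2 - T" by (simp add: power2_eq_square algebra_simps)
  also have "\<dots> \<le> T\<^sup>2 / (1 - \<nu>) - T"
    using assms by (simp add: field_simps)
  also have "\<dots> = (front \<nu> t - sqrt t) * t powr (- \<nu>)"
    using t by (simp add: left_diff_distrib fr sq T_def powr_add[symmetric])
  also have "\<dots> \<le> x * t powr (- \<nu>)"
    using x by (intro mult_right_mono) auto
  finally have s: "6 \<le> x * t powr (- \<nu>)" .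
  then show "0 \<le> x" using mult_nonpos_nonneg[of x "t powr (- \<nu>)"] by fastforce
  have "exp (- (x * t powr (- \<nu>))) \<le> exp (- 6)" using s by simp
  also have "exp (- 6 :: real) \<le> 1 / 7"
    using exp_ge_add_one_self[of "6::real"] by (simp add: exp_minus field_simps)
  finally have e: "exp (- (x * t powr (- \<nu>))) \<le> 1 / 7" .
  have "(x - front \<nu> t)\<^sup>2 \<le> (sqrt t)\<^sup>2" using x by (intro abs_le_square_iff[THEN iffD1]) auto
  then have "(x - front \<nu> t)\<^sup>2 \<le> t" using t by simp
  then show "1/2 \<le> barrier \<nu> (t, x)"
    using e t by (simp add: barrier_def \<tau>_def)
qed


section \<open>Comparison of odd test functions with the barrier\<close>

text \<open>
  The operator commutes with reflection in \<open>x\<close>, so that a test function can be replaced by its odd part,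
  which vanishes at \<open>x = 0\<close>. On the half line \<open>x > 0\<close> the drift is then simply \<open>t powr (- \<nu>)\<close>.
\<close>

definition odd_part :: "(real \<times> real \<Rightarrow> real) \<Rightarrow> real \<times> real \<Rightarrow> real"
  where "odd_part v = (\<lambda>(t, x). (v (t, x) - v (t, - x)) / 2)"

definition even_part :: "(real \<times> real \<Rightarrow> real) \<Rightarrow> real \<times> real \<Rightarrow> real"
  where "even_part v = (\<lambda>(t, x). (v (t, x) + v (t, - x)) / 2)"

lemma C12_0_D:
  assumes "u \<in> C12_0"
  shows C12_0_DERIV_t: "t \<in> {0..1} \<Longrightarrow> ((\<lambda>s. u (s, x)) has_real_derivative Dt u (t, x)) (at t within {0..1})"
    and C12_0_DERIV_x: "t \<in> {0..1} \<Longrightarrow> ((\<lambda>y. u (t, y)) has_real_derivative Dx u (t, x)) (at x)"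
    and C12_0_DERIV_xx: "t \<in> {0..1} \<Longrightarrow> ((\<lambda>y. Dx u (t, y)) has_real_derivative Dx (Dx u) (t, x)) (at x)"
    and C12_0_cont: "continuous_on closed_strip u" "continuous_on closed_strip (Dt u)"
      "continuous_on closed_strip (Dx u)" "continuous_on closed_strip (Dx (Dx u))"
    and C12_0_final: "u (1, x) = 0"
    and C12_0_support: "\<exists>R. \<forall>t\<in>{0..1}. \<forall>x. \<bar>x\<bar> > R \<longrightarrow> u (t, x) = 0"
  using assms
  by (auto simp: C12_0_def Dt_def Dx_def has_real_derivative_iff_has_vector_derivative
      DERIV_deriv_iff_real_differentiable[unfolded has_real_derivative_iff_has_vector_derivative]
      vector_derivative_works[symmetric])

lemma DERIV_reflect:
  assumes "\<And>x. ((\<lambda>y. v (t, y)) has_real_derivative v' (t, x)) (at x)"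
  shows "((\<lambda>y. v (t, - y)) has_real_derivative - v' (t, - x)) (at x)"
proof -
  have "(uminus has_real_derivative - 1) (at x)"
    using DERIV_minus[OF DERIV_ident, of x] by simp
  from DERIV_chain2[OF assms this] show ?thesis by simp
qed

lemma odd_part_DERIV:
  assumes u: "u \<in> C12_0" and t: "t \<in> {0..1}"
  shows "((\<lambda>s. odd_part u (s, x)) has_real_derivative odd_part (Dt u) (t, x)) (at t within {0..1})"
    "((\<lambda>y. odd_part u (t, y)) has_real_derivative even_part (Dx u) (t, x)) (at x)"
    "((\<lambda>y. even_part (Dx u) (t, y)) has_real_derivative odd_part (Dx (Dx u)) (t, x)) (at x)"
proof -
  note d = C12_0_DERIV_x[OF u t] C12_0_DERIV_xx[OF u t]
  note r = DERIV_reflect[of u t "Dx u", OF d(1)] DERIV_reflect[of "Dx u" t "Dx (Dx u)", OF d(2)]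
  show "((\<lambda>s. odd_part u (s, x)) has_real_derivative odd_part (Dt u) (t, x)) (at t within {0..1})"
    unfolding odd_part_def prod.case
    by (intro DERIV_cdivide DERIV_diff C12_0_DERIV_t[OF u t])
  show "((\<lambda>y. odd_part u (t, y)) has_real_derivative even_part (Dx u) (t, x)) (at x)"
    using DERIV_cdivide[OF DERIV_diff[OF d(1) r(1)], of 2 x]
    by (simp add: odd_part_def even_part_def)
  show "((\<lambda>y. even_part (Dx u) (t, y)) has_real_derivative odd_part (Dx (Dx u)) (t, x)) (at x)"
    using DERIV_cdivide[OF DERIV_add[OF d(2) r(2)], of 2 x]
    by (simp add: odd_part_def even_part_def)
qed

lemma continuous_on_parts:
  assumes "continuous_on closed_strip v"
  shows "continuous_on closed_strip (odd_part v)" "continuous_on closed_strip (even_part v)"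
proof -
  have r: "continuous_on closed_strip (\<lambda>z. v (fst z, - snd z))"
    by (rule continuous_on_compose2[OF assms]) (auto intro!: continuous_intros)
  show "continuous_on closed_strip (odd_part v)" "continuous_on closed_strip (even_part v)"
    unfolding odd_part_def even_part_def split_beta prod.collapse
    by (intro continuous_intros r assms; simp)+
qed

text \<open>
  How far the truncated barrier lies above the odd part of \<open>u\<close>. The inner \<open>ramp\<close> makes the barrier
  nonnegative and compactly supported, so that the defect of its generator is supported in a set that does not
  depend on \<open>u\<close>.
\<close>

definition gap :: "real \<Rightarrow> (real \<times> real \<Rightarrow> real) \<Rightarrow> real \<times> real \<Rightarrow> real"
  where "gap \<nu> u = (\<lambda>z. ramp (barrier \<nu> z) - odd_part u z)"

definition gap_t :: "real \<Rightarrow> (real \<times> real \<Rightarrow> real) \<Rightarrow> real \<times> real \<Rightarrow> real"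
  where "gap_t \<nu> u = (\<lambda>z. ramp1 (barrier \<nu> z) * barrier_t \<nu> z - odd_part (Dt u) z)"

definition gap_x :: "real \<Rightarrow> (real \<times> real \<Rightarrow> real) \<Rightarrow> real \<times> real \<Rightarrow> real"
  where "gap_x \<nu> u = (\<lambda>z. ramp1 (barrier \<nu> z) * barrier_x \<nu> z - even_part (Dx u) z)"

definition gap_xx :: "real \<Rightarrow> (real \<times> real \<Rightarrow> real) \<Rightarrow> real \<times> real \<Rightarrow> real"
  where "gap_xx \<nu> u = (\<lambda>z. ramp2 (barrier \<nu> z) * (barrier_x \<nu> z)\<^sup>2
    + ramp1 (barrier \<nu> z) * barrier_xx \<nu> z - odd_part (Dx (Dx u)) z)"

lemma gap_DERIV:
  assumes "\<nu> < 1" and u: "u \<in> C12_0" and t: "0 < t" "t \<le> 1"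
  shows "((\<lambda>s. gap \<nu> u (s, x)) has_real_derivative gap_t \<nu> u (t, x)) (at t within {0..1})"
    "((\<lambda>y. gap \<nu> u (t, y)) has_real_derivative gap_x \<nu> u (t, x)) (at x)"
    "((\<lambda>y. gap_x \<nu> u (t, y)) has_real_derivative gap_xx \<nu> u (t, x)) (at x)"
proof -
  have t': "t \<in> {0..1}" using t by simp
  note U = odd_part_DERIV[OF u t'] and W = DERIV_barrier[OF assms(1) t(1)]
  show "((\<lambda>s. gap \<nu> u (s, x)) has_real_derivative gap_t \<nu> u (t, x)) (at t within {0..1})"
    unfolding gap_def gap_t_def
    by (intro DERIV_diff U DERIV_chain2[OF DERIV_ramp] has_field_derivative_at_within[OF W(1)])
  show "((\<lambda>y. gap \<nu> u (t, y)) has_real_derivative gap_x \<nu> u (t, x)) (at x)"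
    unfolding gap_def gap_x_def
    by (intro DERIV_diff U DERIV_chain2[OF DERIV_ramp] W)
  have "((\<lambda>y. ramp1 (barrier \<nu> (t, y)) * barrier_x \<nu> (t, y)) has_real_derivative
     ramp2 (barrier \<nu> (t, x)) * barrier_x \<nu> (t, x) * barrier_x \<nu> (t, x) + barrier_xx \<nu> (t, x) * ramp1 (barrier \<nu> (t, x))) (at x)"
    by (intro DERIV_mult DERIV_chain2[OF DERIV_ramp1] W)
  from DERIV_diff[OF this U(3)]
  show "((\<lambda>y. gap_x \<nu> u (t, y)) has_real_derivative gap_xx \<nu> u (t, x)) (at x)"
    by (simp add: gap_x_def gap_xx_def power2_eq_square mult_ac)
qed

text \<open>
  The truncation of the gap to its positive values vanishes to first order wherever the gap
  is not positive, in particular at \<open>t = 1\<close>, at \<open>x = 0\<close> and for large \<open>x\<close>.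
\<close>

definition excess :: "real \<Rightarrow> (real \<times> real \<Rightarrow> real) \<Rightarrow> real \<times> real \<Rightarrow> real"
  where "excess \<nu> u = (\<lambda>z. ramp (gap \<nu> u z))"

definition excess_t :: "real \<Rightarrow> (real \<times> real \<Rightarrow> real) \<Rightarrow> real \<times> real \<Rightarrow> real"
  where "excess_t \<nu> u = (\<lambda>z. ramp1 (gap \<nu> u z) * gap_t \<nu> u z)"

definition excess_x :: "real \<Rightarrow> (real \<times> real \<Rightarrow> real) \<Rightarrow> real \<times> real \<Rightarrow> real"
  where "excess_x \<nu> u = (\<lambda>z. ramp1 (gap \<nu> u z) * gap_x \<nu> u z)"

definition excess_xx :: "real \<Rightarrow> (real \<times> real \<Rightarrow> real) \<Rightarrow> real \<times> real \<Rightarrow> real"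
  where "excess_xx \<nu> u = (\<lambda>z. ramp2 (gap \<nu> u z) * (gap_x \<nu> u z)\<^sup>2 + ramp1 (gap \<nu> u z) * gap_xx \<nu> u z)"

lemma excess_DERIV:
  assumes "\<nu> < 1" and u: "u \<in> C12_0" and t: "0 < t" "t \<le> 1"
  shows "((\<lambda>s. excess \<nu> u (s, x)) has_real_derivative excess_t \<nu> u (t, x)) (at t within {0..1})"
    "((\<lambda>y. excess \<nu> u (t, y)) has_real_derivative excess_x \<nu> u (t, x)) (at x)"
    "((\<lambda>y. excess_x \<nu> u (t, y)) has_real_derivative excess_xx \<nu> u (t, x)) (at x)"
proof -
  note G = gap_DERIV[OF assms]
  show "((\<lambda>s. excess \<nu> u (s, x)) has_real_derivative excess_t \<nu> u (t, x)) (at t within {0..1})"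
    unfolding excess_def excess_t_def
    by (intro DERIV_chain2[OF DERIV_ramp] G)
  show "((\<lambda>y. excess \<nu> u (t, y)) has_real_derivative excess_x \<nu> u (t, x)) (at x)"
    unfolding excess_def excess_x_def
    by (intro DERIV_chain2[OF DERIV_ramp] G)
  have "((\<lambda>y. ramp1 (gap \<nu> u (t, y)) * gap_x \<nu> u (t, y)) has_real_derivative
     ramp2 (gap \<nu> u (t, x)) * gap_x \<nu> u (t, x) * gap_x \<nu> u (t, x) + gap_xx \<nu> u (t, x) * ramp1 (gap \<nu> u (t, x))) (at x)"
    by (intro DERIV_mult DERIV_chain2[OF DERIV_ramp1] G)
  then show "((\<lambda>y. excess_x \<nu> u (t, y)) has_real_derivative excess_xx \<nu> u (t, x)) (at x)"
    by (simp add: excess_x_def excess_xx_def power2_eq_square mult_ac)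
qed

lemma continuous_on_excess:
  assumes "\<nu> < 1" and u: "u \<in> C12_0" and S: "S \<subseteq> {0<..1} \<times> UNIV"
  shows "continuous_on S (excess \<nu> u)" "continuous_on S (excess_t \<nu> u)"
    "continuous_on S (excess_x \<nu> u)" "continuous_on S (excess_xx \<nu> u)"
proof -
  have "S \<subseteq> closed_strip" "S \<subseteq> {0<..} \<times> UNIV" using S by force+
  note U = continuous_on_subset[OF continuous_on_parts(1)[OF C12_0_cont(1)[OF u]] this(1)]
    continuous_on_subset[OF continuous_on_parts(1)[OF C12_0_cont(2)[OF u]] this(1)]
    continuous_on_subset[OF continuous_on_parts(2)[OF C12_0_cont(3)[OF u]] this(1)]
    continuous_on_subset[OF continuous_on_parts(1)[OF C12_0_cont(4)[OF u]] this(1)]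
  note W = continuous_on_barrier[OF assms(1) \<open>S \<subseteq> {0<..} \<times> UNIV\<close>]
  have R: "continuous_on S (\<lambda>z. ramp (h z))" "continuous_on S (\<lambda>z. ramp1 (h z))" "continuous_on S (\<lambda>z. ramp2 (h z))"
    if "continuous_on S h" for h
    using that by (auto intro!: continuous_on_compose2[OF ramp_continuous(1)[of UNIV]]
      continuous_on_compose2[OF ramp_continuous(2)[of UNIV]] continuous_on_compose2[OF ramp_continuous(3)[of UNIV]])
  have G: "continuous_on S (gap \<nu> u)" "continuous_on S (gap_t \<nu> u)"
    "continuous_on S (gap_x \<nu> u)" "continuous_on S (gap_xx \<nu> u)"
    unfolding gap_def gap_t_def gap_x_def gap_xx_def
    by (intro continuous_intros R U W)+
  show "continuous_on S (excess \<nu> u)" "continuous_on S (excess_t \<nu> u)"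
    "continuous_on S (excess_x \<nu> u)" "continuous_on S (excess_xx \<nu> u)"
    unfolding excess_def excess_t_def excess_x_def excess_xx_def
    by (intro continuous_intros R G)+
qed

lemma excess_eq_0:
  assumes "gap \<nu> u z \<le> 0"
  shows "excess \<nu> u z = 0 \<and> excess_x \<nu> u z = 0"
  using assms by (simp add: excess_def excess_x_def ramp_nonpos)

text \<open>
  The element of \<open>Lpq p q\<close> that stays away from the range of the operator: the odd function whose value
  on the right half line is the lower bound \<open>- \<Psi>\<close> for the generator of the truncated barrier, cut off
  where the barrier is nonpositive.
\<close>

definition source :: "real \<Rightarrow> real \<Rightarrow> real \<times> real \<Rightarrow> real"
  where "source \<nu> \<Psi> = (\<lambda>(t, x). - \<Psi> * sgn x * indicator {- (1 + 1 / (1 - \<nu>))..1 + 1 / (1 - \<nu>)} x)"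

text \<open>
  The generator of the truncated barrier is at least \<open>source\<close> and that of the odd part of \<open>u\<close> is the odd
  part of \<open>Lop \<nu> u\<close>. So the generator of the gap is at least the odd part of the residual \<open>e\<close>, and
  composing with \<open>ramp\<close> multiplies this bound by a number in \<open>[0,1]\<close> and adds a nonnegative second-order term.
\<close>

lemma excess_generator_ge:
  fixes \<nu> \<Psi> t x :: real and u :: "real \<times> real \<Rightarrow> real"
  defines "e \<equiv> (\<lambda>z. source \<nu> \<Psi> z - Lop \<nu> u z)"
  assumes \<nu>: "\<nu> < 1" and \<Psi>: "0 < \<Psi>" and t: "0 < t" "t \<le> 1" and x: "0 < x"
    and gen: "- \<Psi> \<le> barrier_t \<nu> (t, x) + 1/2 * barrier_xx \<nu> (t, x) + t powr (- \<nu>) * barrier_x \<nu> (t, x)"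
  shows "- ((\<bar>e (t, x)\<bar> + \<bar>e (t, - x)\<bar>) / 2)
    \<le> excess_t \<nu> u (t, x) + 1/2 * excess_xx \<nu> u (t, x) + t powr (- \<nu>) * excess_x \<nu> u (t, x)"
proof -
  define w where "w = barrier \<nu> (t, x)"
  define Lw where "Lw = barrier_t \<nu> (t, x) + 1/2 * barrier_xx \<nu> (t, x) + t powr (- \<nu>) * barrier_x \<nu> (t, x)"
  define Lg where "Lg = gap_t \<nu> u (t, x) + 1/2 * gap_xx \<nu> u (t, x) + t powr (- \<nu>) * gap_x \<nu> u (t, x)"
  have src: "source \<nu> \<Psi> (t, - x) = - source \<nu> \<Psi> (t, x)"
    using \<nu> by (auto simp: source_def indicator_def)
  have "source \<nu> \<Psi> (t, x) \<le> ramp1 w * Lw"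
  proof (cases "w \<le> 0")
    case True
    then show ?thesis using x \<Psi> by (simp add: ramp_nonpos source_def)
  next
    case False
    then have "x \<le> 1 + 1 / (1 - \<nu>)"
      using barrier_far[OF \<nu> t, of x] unfolding w_def by linarith
    then have "source \<nu> \<Psi> (t, x) = - \<Psi>"
      using x \<nu> by (auto simp: source_def indicator_def)
    also have "\<dots> \<le> ramp1 w * (- \<Psi>)"
      using \<Psi> ramp1_bounds[of w] by simp
    also have "\<dots> \<le> ramp1 w * Lw"
      using gen ramp1_bounds[of w] unfolding Lw_def by (intro mult_left_mono)
    finally show ?thesis .
  qed
  moreover have "Lg = ramp1 w * Lw + 1/2 * ramp2 w * (barrier_x \<nu> (t, x))\<^sup>2 - (Lop \<nu> u (t, x) - Lop \<nu> u (t, - x)) / 2"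
    using t x
    by (simp add: Lg_def Lw_def w_def gap_t_def gap_xx_def gap_x_def Lop_def drift_def odd_part_def even_part_def)
      (simp add: field_simps)
  moreover have "0 \<le> 1/2 * ramp2 w * (barrier_x \<nu> (t, x))\<^sup>2"
    using ramp2_nonneg by simp
  moreover have "(e (t, x) - e (t, - x)) / 2 = source \<nu> \<Psi> (t, x) - (Lop \<nu> u (t, x) - Lop \<nu> u (t, - x)) / 2"
    by (simp add: e_def src field_simps)
  ultimately have "(e (t, x) - e (t, - x)) / 2 \<le> Lg" by linarith
  then have "- ((\<bar>e (t, x)\<bar> + \<bar>e (t, - x)\<bar>) / 2) \<le> Lg"
    using abs_ge_minus_self[of "e (t, x)"] abs_ge_self[of "e (t, - x)"] by (simp add: field_simps)
  then have "- ((\<bar>e (t, x)\<bar> + \<bar>e (t, - x)\<bar>) / 2) \<le> min 0 Lg"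
    by simp
  also have "\<dots> \<le> ramp1 (gap \<nu> u (t, x)) * Lg"
  proof (cases "0 \<le> Lg")
    case True
    then show ?thesis using ramp1_bounds by simp
  next
    case False
    then show ?thesis
      using ramp1_bounds[of "gap \<nu> u (t, x)"] by (simp add: mult_le_cancel_right1)
  qed
  finally have "- ((\<bar>e (t, x)\<bar> + \<bar>e (t, - x)\<bar>) / 2) \<le> ramp1 (gap \<nu> u (t, x)) * Lg" .
  moreover have "0 \<le> 1/2 * ramp2 (gap \<nu> u (t, x)) * (gap_x \<nu> u (t, x))\<^sup>2"
    using ramp2_nonneg by simp
  moreover have "excess_t \<nu> u (t, x) + 1/2 * excess_xx \<nu> u (t, x) + t powr (- \<nu>) * excess_x \<nu> u (t, x)
     = ramp1 (gap \<nu> u (t, x)) * Lg + 1/2 * ramp2 (gap \<nu> u (t, x)) * (gap_x \<nu> u (t, x))\<^sup>2"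
    by (simp add: excess_t_def excess_xx_def excess_x_def Lg_def) (simp add: field_simps)
  ultimately show ?thesis by (simp only: add_increasing2)
qed


lemma source_measurable [measurable]: "source \<nu> \<Psi> \<in> borel_measurable borel"
proof -
  have "source \<nu> \<Psi> \<in> borel_measurable (borel \<Otimes>\<^sub>M borel)"
    unfolding source_def by measurable
  then show ?thesis by (simp add: borel_prod)
qed

lemma Lop_measurable:
  assumes "u \<in> C12_0"
  shows "(\<lambda>z. indicator open_strip z * Lop \<nu> u z) \<in> borel_measurable borel"
proof -
  have "drift \<nu> \<in> borel_measurable (borel \<Otimes>\<^sub>M borel)"
    unfolding drift_def by measurable
  then have [measurable]: "drift \<nu> \<in> borel_measurable borel" by (simp add: borel_prod)
  have "open (open_strip :: (real \<times> real) set)" by (intro open_Times) auto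
  then have S: "open_strip \<in> sets borel" by simp
  have sub: "open_strip \<subseteq> closed_strip" by auto
  have [measurable]: "(\<lambda>z. indicator open_strip z * v z) \<in> borel_measurable borel"
    if "continuous_on closed_strip v" for v :: "real \<times> real \<Rightarrow> real"
    using borel_measurable_continuous_on_indicator[OF S continuous_on_subset[OF that sub]] by simp
  have "(\<lambda>z. indicator open_strip z * Dt u z + 1/2 * (indicator open_strip z * Dx (Dx u) z)
      + drift \<nu> z * (indicator open_strip z * Dx u z)) \<in> borel_measurable borel"
    using C12_0_cont[OF assms] by measurable
  also have "(\<lambda>z. indicator open_strip z * Dt u z + 1/2 * (indicator open_strip z * Dx (Dx u) z)
      + drift \<nu> z * (indicator open_strip z * Dx u z)) = (\<lambda>z. indicator open_strip z * Lop \<nu> u z)"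
    by (auto simp: Lop_def algebra_simps)
  finally show ?thesis .
qed

lemma residual_measurable:
  assumes "u \<in> C12_0"
  shows "(\<lambda>z. indicator open_strip z * (source \<nu> \<Psi> z - Lop \<nu> u z)) \<in> borel_measurable borel"
proof -
  have "open (open_strip :: (real \<times> real) set)" by (intro open_Times) auto
  then have [measurable]: "open_strip \<in> sets borel" by simp
  note Lop_measurable[OF assms, measurable]
  show ?thesis unfolding right_diff_distrib by measurable
qed

text \<open>
  Pairing with the symmetrized density accounts for both values \<open>e (t, x)\<close> and \<open>e (t, - x)\<close> of the
  residual that passing to the odd part brings in.
\<close>

definition sym_front_density :: "real \<Rightarrow> real \<times> real \<Rightarrow> real"
  where "sym_front_density \<nu> = even_part (front_density \<nu>)"

lemma nn_integral_reflect:
  fixes f :: "real \<Rightarrow> ennreal"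
  assumes "f \<in> borel_measurable borel"
  shows "(\<integral>\<^sup>+x. f (- x) \<partial>lborel) = (\<integral>\<^sup>+x. f x \<partial>lborel)"
  using nn_integral_real_affine[OF assms, of "-1" 0] by simp

lemma section_measurable:
  fixes f :: "real \<times> real \<Rightarrow> real"
  assumes "f \<in> borel_measurable borel"
  shows "(\<lambda>x. f (t, x)) \<in> borel_measurable borel" "(\<lambda>x. f (t, - x)) \<in> borel_measurable borel"
  by (intro measurable_compose[OF _ assms] borel_measurable_continuous_onI continuous_intros)+

lemma sym_front_density_measurable: "sym_front_density \<nu> \<in> borel_measurable borel"
proof -
  have "(\<lambda>z::real \<times> real. (fst z, - snd z)) \<in> borel_measurable borel"
    by (intro borel_measurable_continuous_onI continuous_intros)
  from measurable_compose[OF this front_density_measurable] show ?thesis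
    unfolding sym_front_density_def even_part_def split_beta prod.collapse by measurable
qed

lemma sym_front_density_nonneg: "0 \<le> sym_front_density \<nu> z"
  using front_density_nonneg by (auto simp: sym_front_density_def even_part_def split_beta)

lemma sym_front_density_le: "0 < t \<Longrightarrow> sym_front_density \<nu> (t, x) \<le> t powr (-1/2)"
  using front_density_le[of t \<nu> x] front_density_le[of t \<nu> "- x"] by (simp add: sym_front_density_def even_part_def)

lemma nn_integral_sym_front_density_mult:
  assumes v: "v \<in> borel_measurable borel"
  shows "(\<integral>\<^sup>+x. ennreal (sym_front_density \<nu> (t, x) * \<bar>v x\<bar>) \<partial>lborel)
     = (\<integral>\<^sup>+x. ennreal (front_density \<nu> (t, x) * ((\<bar>v x\<bar> + \<bar>v (- x)\<bar>) / 2)) \<partial>lborel)"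
proof -
  note [measurable] = v measurable_compose[OF _ v]
  have "(\<integral>\<^sup>+x. ennreal (sym_front_density \<nu> (t, x) * \<bar>v x\<bar>) \<partial>lborel)
     = (\<integral>\<^sup>+x. ennreal (front_density \<nu> (t, x) * \<bar>v x\<bar> / 2) + ennreal (front_density \<nu> (t, - x) * \<bar>v x\<bar> / 2) \<partial>lborel)"
    using front_density_nonneg by (intro nn_integral_cong)
      (auto simp: sym_front_density_def even_part_def ennreal_plus[symmetric] field_simps simp del: ennreal_plus)
  also have "\<dots> = (\<integral>\<^sup>+x. ennreal (front_density \<nu> (t, x) * \<bar>v x\<bar> / 2) \<partial>lborel) + (\<integral>\<^sup>+x. ennreal (front_density \<nu> (t, - x) * \<bar>v x\<bar> / 2) \<partial>lborel)"
    by (intro nn_integral_add) measurable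
  also have "(\<integral>\<^sup>+x. ennreal (front_density \<nu> (t, - x) * \<bar>v x\<bar> / 2) \<partial>lborel)
      = (\<integral>\<^sup>+x. ennreal (front_density \<nu> (t, x) * \<bar>v (- x)\<bar> / 2) \<partial>lborel)"
    using nn_integral_reflect[of "\<lambda>x. ennreal (front_density \<nu> (t, - x) * \<bar>v x\<bar> / 2)"] by simp
  also have "(\<integral>\<^sup>+x. ennreal (front_density \<nu> (t, x) * \<bar>v x\<bar> / 2) \<partial>lborel) + \<dots>
     = (\<integral>\<^sup>+x. ennreal (front_density \<nu> (t, x) * \<bar>v x\<bar> / 2) + ennreal (front_density \<nu> (t, x) * \<bar>v (- x)\<bar> / 2) \<partial>lborel)"
    by (intro nn_integral_add[symmetric]) measurable
  also have "\<dots> = (\<integral>\<^sup>+x. ennreal (front_density \<nu> (t, x) * ((\<bar>v x\<bar> + \<bar>v (- x)\<bar>) / 2)) \<partial>lborel)"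
    using front_density_nonneg by (intro nn_integral_cong)
      (auto simp: ennreal_plus[symmetric] field_simps simp del: ennreal_plus)
  finally show ?thesis .
qed

lemma nn_integral_sym_front_density:
  assumes "0 < t"
  shows "(\<integral>\<^sup>+x. ennreal (sym_front_density \<nu> (t, x)) \<partial>lborel) = 1"
  using nn_integral_sym_front_density_mult[of "\<lambda>_. 1" \<nu> t] nn_integral_front_density[OF assms] by simp

lemma ennreal_iterated_integral_le:
  fixes H :: "real \<times> real \<Rightarrow> real"
  assumes cont: "continuous_on ({t0..t1} \<times> {x0..x1}) H"
  shows "ennreal (integral {t0..t1} (\<lambda>t. integral {x0..x1} (\<lambda>x. H (t, x))))
    \<le> (\<integral>\<^sup>+t\<in>{t0..t1}. (\<integral>\<^sup>+x\<in>{x0..x1}. ennreal (H (t, x)) \<partial>lborel) \<partial>lborel)"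
proof -
  define P where "P z = max 0 (H z)" for z
  have P0: "0 \<le> P z" for z by (simp add: P_def)
  have contP: "continuous_on ({t0..t1} \<times> {x0..x1}) P"
    unfolding P_def by (intro continuous_intros cont)
  have sect: "(\<lambda>x. h (t, x)) integrable_on {x0..x1}"
    if "continuous_on ({t0..t1} \<times> {x0..x1}) h" "t \<in> {t0..t1}" for h :: "real \<times> real \<Rightarrow> real" and t
    using that(2) by (intro integrable_continuous_real continuous_on_compose2[OF that(1)] continuous_intros) auto
  have outer: "(\<lambda>t. integral {x0..x1} (\<lambda>x. h (t, x))) integrable_on {t0..t1}"
    if "continuous_on ({t0..t1} \<times> {x0..x1}) h" for h :: "real \<times> real \<Rightarrow> real"
    using integral_continuous_on_param[of "{t0..t1}" x0 x1 "\<lambda>t x. h (t, x)"] that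
    by (intro integrable_continuous_real) (simp add: split_def)
  have "integral {t0..t1} (\<lambda>t. integral {x0..x1} (\<lambda>x. H (t, x))) \<le> integral {t0..t1} (\<lambda>t. integral {x0..x1} (\<lambda>x. P (t, x)))"
    by (intro integral_le outer[OF cont] outer[OF contP] sect[OF cont] sect[OF contP]) (auto simp: P_def)
  then have "ennreal (integral {t0..t1} (\<lambda>t. integral {x0..x1} (\<lambda>x. H (t, x))))
     \<le> ennreal (integral {t0..t1} (\<lambda>t. integral {x0..x1} (\<lambda>x. P (t, x))))"
    by (rule ennreal_leI)
  also have "\<dots> = (\<integral>\<^sup>+t\<in>{t0..t1}. ennreal (integral {x0..x1} (\<lambda>x. P (t, x))) \<partial>lborel)"
    by (rule nn_integral_has_integral_lebesgue'[symmetric])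
      (auto intro!: integral_nonneg sect[OF contP] integrable_integral outer[OF contP] P0)
  also have "\<dots> = (\<integral>\<^sup>+t\<in>{t0..t1}. (\<integral>\<^sup>+x\<in>{x0..x1}. ennreal (H (t, x)) \<partial>lborel) \<partial>lborel)"
  proof (intro nn_integral_cong)
    fix t
    show "ennreal (integral {x0..x1} (\<lambda>x. P (t, x))) * indicator {t0..t1} t
      = (\<integral>\<^sup>+x\<in>{x0..x1}. ennreal (H (t, x)) \<partial>lborel) * indicator {t0..t1} t"
    proof (cases "t \<in> {t0..t1}")
      case True
      have "ennreal (integral {x0..x1} (\<lambda>x. P (t, x))) = (\<integral>\<^sup>+x\<in>{x0..x1}. ennreal (P (t, x)) \<partial>lborel)"
        by (rule nn_integral_has_integral_lebesgue'[symmetric])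
          (auto intro!: integrable_integral sect[OF contP True] P0)
      also have "(\<lambda>x. ennreal (P (t, x))) = (\<lambda>x. ennreal (H (t, x)))"
        by (auto simp: P_def max_def ennreal_neg)
      finally show ?thesis by simp
    qed simp
  qed
  finally show ?thesis .
qed

text \<open>
  Green's identity turns the mass of the excess at time \<open>t0\<close> into the space-time integral of minus its
  generator, which the residual \<open>e\<close> dominates. The bound does not involve \<open>t0\<close> or \<open>u\<close> other than through \<open>e\<close>.
\<close>

lemma excess_integral_le:
  fixes \<nu> \<Psi> R t0 :: real and u :: "real \<times> real \<Rightarrow> real"
  defines "e \<equiv> (\<lambda>z. indicator open_strip z * (source \<nu> \<Psi> z - Lop \<nu> u z))"
  assumes \<nu>: "\<nu> < 1" and \<Psi>: "0 < \<Psi>" and t0: "0 < t0" "t0 < 1" and u: "u \<in> C12_0"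
    and gen: "\<And>t x. 0 < t \<Longrightarrow> t \<le> 1 \<Longrightarrow> 0 \<le> x \<Longrightarrow>
      - \<Psi> \<le> barrier_t \<nu> (t, x) + 1/2 * barrier_xx \<nu> (t, x) + t powr (- \<nu>) * barrier_x \<nu> (t, x)"
    and R: "1 + 1 / (1 - \<nu>) \<le> R" "\<And>t. t \<in> {0..1} \<Longrightarrow> u (t, R) = 0 \<and> u (t, - R) = 0"
  shows "ennreal (integral {0..R} (\<lambda>x. front_density \<nu> (t0, x) * excess \<nu> u (t0, x)))
    \<le> (\<integral>\<^sup>+t\<in>{0<..<1}. (\<integral>\<^sup>+x. ennreal (sym_front_density \<nu> (t, x) * \<bar>e (t, x)\<bar>) \<partial>lborel) \<partial>lborel)"
proof -
  have e_meas: "e \<in> borel_measurable borel"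
    unfolding e_def by (rule residual_measurable[OF u])
  have Rpos: "0 < R"
  proof -
    have "0 < 1 + 1 / (1 - \<nu>)" using \<nu> by (intro add_pos_nonneg) auto
    then show ?thesis using R(1) by linarith
  qed
  define Q where "Q = {t0..1} \<times> {0..R}"
  have Q: "Q \<subseteq> {0<..1} \<times> UNIV" "Q \<subseteq> {0<..} \<times> UNIV"
    using t0 by (auto simp: Q_def)
  define Le where "Le = (\<lambda>(t, x). excess_t \<nu> u (t, x) + 1/2 * excess_xx \<nu> u (t, x) + t powr (- \<nu>) * excess_x \<nu> u (t, x))"
  have gap0: "gap \<nu> u (t, x) \<le> 0" if "t \<in> {t0..1}" "x = 0 \<or> x = R \<or> t = 1 \<and> 0 \<le> x" for t x
  proof -
    have "barrier \<nu> (t, x) \<le> 0"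
      using that t0 barrier_at_0[of t \<nu>] barrier_far[OF \<nu>, of t R] barrier_final[of \<nu> x] R(1) by auto
    moreover have "odd_part u (t, x) = 0"
      using that t0 R(2)[of t] C12_0_final[OF u] by (auto simp: odd_part_def)
    ultimately show ?thesis by (simp add: gap_def ramp_nonpos)
  qed
  have "integral {t0..1} (\<lambda>t. integral {0..R} (\<lambda>x. front_density \<nu> (t, x) *
        (excess_t \<nu> u (t, x) + 1/2 * excess_xx \<nu> u (t, x) + t powr (- \<nu>) * excess_x \<nu> u (t, x))))
     = - integral {0..R} (\<lambda>x. front_density \<nu> (t0, x) * excess \<nu> u (t0, x))"
  proof (rule parabolic_duality)
    show "t0 \<le> 1" "0 \<le> R" using t0 Rpos by auto
    show "continuous_on ({t0..1} \<times> {0..R}) (front_density \<nu>)" "continuous_on ({t0..1} \<times> {0..R}) (front_density_t \<nu>)"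
      "continuous_on ({t0..1} \<times> {0..R}) (excess \<nu> u)" "continuous_on ({t0..1} \<times> {0..R}) (excess_t \<nu> u)"
      using continuous_on_front_density[OF \<nu> Q(2)] continuous_on_excess[OF \<nu> u Q(1)] by (auto simp: Q_def)
    fix t x assume tx: "(t, x) \<in> {t0..1} \<times> {0..R}"
    then have t: "0 < t" "t \<le> 1" using t0 by auto
    show "((\<lambda>s. front_density \<nu> (s, x)) has_real_derivative front_density_t \<nu> (t, x)) (at t within {t0..1})"
      by (rule has_field_derivative_at_within[OF DERIV_front_density_t[OF \<nu> t(1)]])
    show "((\<lambda>y. front_density \<nu> (t, y)) has_real_derivative front_density_x \<nu> (t, x)) (at x within {0..R})"
      "((\<lambda>y. front_density_x \<nu> (t, y)) has_real_derivative front_density_xx \<nu> (t, x)) (at x within {0..R})"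
      by (rule has_field_derivative_at_within[OF DERIV_front_density_x(1)[OF t(1)]]
          has_field_derivative_at_within[OF DERIV_front_density_x(2)[OF t(1)]])+
    show "((\<lambda>s. excess \<nu> u (s, x)) has_real_derivative excess_t \<nu> u (t, x)) (at t within {t0..1})"
      by (rule DERIV_subset[OF excess_DERIV(1)[OF \<nu> u t]]) (use t0 in auto)
    show "((\<lambda>y. excess \<nu> u (t, y)) has_real_derivative excess_x \<nu> u (t, x)) (at x within {0..R})"
      "((\<lambda>y. excess_x \<nu> u (t, y)) has_real_derivative excess_xx \<nu> u (t, x)) (at x within {0..R})"
      by (rule has_field_derivative_at_within[OF excess_DERIV(2)[OF \<nu> u t]]
          has_field_derivative_at_within[OF excess_DERIV(3)[OF \<nu> u t]])+
    show "front_density_t \<nu> (t, x) = 1/2 * front_density_xx \<nu> (t, x) - t powr (- \<nu>) * front_density_x \<nu> (t, x)"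
      by (rule front_density_forward_equation[OF t(1)])
  next
    fix x assume "x \<in> {0..R}"
    then show "excess \<nu> u (1, x) = 0" using gap0[of 1 x] t0 excess_eq_0 by auto
  next
    fix t x assume "t \<in> {t0..1}" "x = 0 \<or> x = R"
    then show "excess \<nu> u (t, x) = 0 \<and> excess_x \<nu> u (t, x) = 0" using gap0 excess_eq_0 by blast
  qed
  then have "integral {0..R} (\<lambda>x. front_density \<nu> (t0, x) * excess \<nu> u (t0, x))
     = integral {t0..1} (\<lambda>t. integral {0..R} (\<lambda>x. - (front_density \<nu> (t, x) * Le (t, x))))"
    by (simp add: Le_def)
  also have "ennreal \<dots> \<le> (\<integral>\<^sup>+t\<in>{t0..1}. (\<integral>\<^sup>+x\<in>{0..R}. ennreal (- (front_density \<nu> (t, x) * Le (t, x))) \<partial>lborel) \<partial>lborel)"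
  proof -
    have "continuous_on Q (\<lambda>z. - (front_density \<nu> z * Le z))"
      unfolding Le_def split_beta prod.collapse
      using Q(2) by (intro continuous_intros continuous_on_front_density[OF \<nu> Q(2)] continuous_on_excess[OF \<nu> u Q(1)]) auto
    then show ?thesis unfolding Q_def by (rule ennreal_iterated_integral_le)
  qed
  also have "\<dots> \<le> (\<integral>\<^sup>+t\<in>{0<..<1}. (\<integral>\<^sup>+x. ennreal (sym_front_density \<nu> (t, x) * \<bar>e (t, x)\<bar>) \<partial>lborel) \<partial>lborel)"
    \<comment> \<open>The pointwise bound is available only for \<open>t < 1\<close> and \<open>x > 0\<close>: at \<open>t = 1\<close> the function \<open>e\<close> is cut off,
      and at \<open>x = 0\<close> the drift jumps.\<close>
  proof (rule nn_integral_mono_AE)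
    have "(\<integral>\<^sup>+x\<in>{0..R}. ennreal (- (front_density \<nu> (t, x) * Le (t, x))) \<partial>lborel) * indicator {t0..1} t
      \<le> (\<integral>\<^sup>+x. ennreal (sym_front_density \<nu> (t, x) * \<bar>e (t, x)\<bar>) \<partial>lborel) * indicator {0<..<1} t" if "t \<noteq> 1" for t
    proof (cases "t \<in> {t0..1}")
      case True
      then have t: "0 < t" "t < 1" using that t0 by auto
      have "(\<integral>\<^sup>+x\<in>{0..R}. ennreal (- (front_density \<nu> (t, x) * Le (t, x))) \<partial>lborel)
        \<le> (\<integral>\<^sup>+x. ennreal (front_density \<nu> (t, x) * ((\<bar>e (t, x)\<bar> + \<bar>e (t, - x)\<bar>) / 2)) \<partial>lborel)"
      proof (rule nn_integral_mono_AE)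
        have "ennreal (- (front_density \<nu> (t, x) * Le (t, x))) * indicator {0..R} x
           \<le> ennreal (front_density \<nu> (t, x) * ((\<bar>e (t, x)\<bar> + \<bar>e (t, - x)\<bar>) / 2))" if "x \<noteq> 0" for x
        proof (cases "x \<in> {0..R}")
          case True
          then have x: "0 < x" using that by auto
          have "- ((\<bar>e (t, x)\<bar> + \<bar>e (t, - x)\<bar>) / 2) \<le> Le (t, x)"
            using excess_generator_ge[OF \<nu> \<Psi> t(1) _ x gen, of u] t x
            by (simp add: e_def Le_def)
          from mult_left_mono[OF this front_density_nonneg[of \<nu> "(t, x)"]]
          have "- (front_density \<nu> (t, x) * Le (t, x)) \<le> front_density \<nu> (t, x) * ((\<bar>e (t, x)\<bar> + \<bar>e (t, - x)\<bar>) / 2)"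
            by simp
          then show ?thesis using True by (simp add: ennreal_leI)
        qed simp
        then show "AE x in lborel. ennreal (- (front_density \<nu> (t, x) * Le (t, x))) * indicator {0..R} x
           \<le> ennreal (front_density \<nu> (t, x) * ((\<bar>e (t, x)\<bar> + \<bar>e (t, - x)\<bar>) / 2))"
          using AE_lborel_singleton[of "0::real"] by (rule eventually_mono[rotated])
      qed
      also have "\<dots> = (\<integral>\<^sup>+x. ennreal (sym_front_density \<nu> (t, x) * \<bar>e (t, x)\<bar>) \<partial>lborel)"
        by (rule nn_integral_sym_front_density_mult[symmetric]) (intro section_measurable e_meas)
      finally show ?thesis using True t by simp
    qed simp
    then show "AE t in lborel. (\<integral>\<^sup>+x\<in>{0..R}. ennreal (- (front_density \<nu> (t, x) * Le (t, x))) \<partial>lborel) * indicator {t0..1} t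
      \<le> (\<integral>\<^sup>+x. ennreal (sym_front_density \<nu> (t, x) * \<bar>e (t, x)\<bar>) \<partial>lborel) * indicator {0<..<1} t"
      using AE_lborel_singleton[of "1::real"] by (rule eventually_mono[rotated])
  qed
  finally show ?thesis .
qed


section \<open>Lower bound for the distance to the range\<close>

lemma front_window_tendsto_0:
  assumes "\<nu> < 1"
  shows "((\<lambda>t. t + front \<nu> t + sqrt t) \<longlongrightarrow> 0) (at_right 0)"
proof -
  have "((\<lambda>t. t) \<longlongrightarrow> 0) (at_right (0::real))" by (rule tendsto_ident_at)
  moreover from this have "((\<lambda>t. sqrt t) \<longlongrightarrow> 0) (at_right 0)"
    using tendsto_real_sqrt by fastforce
  moreover have "((\<lambda>t. t powr (1 - \<nu>)) \<longlongrightarrow> 0) (at_right 0)"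
    using assms by (intro tendsto_zero_powrI[where b = "1 - \<nu>"] tendsto_ident_at tendsto_const) (auto simp: eventually_at_filter)
  then have "((\<lambda>t. front \<nu> t) \<longlongrightarrow> 0 / (1 - \<nu>)) (at_right 0)"
    unfolding front_def using assms by (intro tendsto_divide tendsto_const) auto
  ultimately show ?thesis
    using tendsto_add[of "\<lambda>t. t + front \<nu> t" 0 "at_right 0" sqrt 0]
      tendsto_add[of "\<lambda>t. t" 0 "at_right 0" "front \<nu>" 0] by simp
qed

text \<open>
  For small \<open>t0\<close>, a fixed proportion of the mass of the density sits within \<open>sqrt t0\<close> of the front. There
  the truncated barrier is at least \<open>ramp (1/2)\<close>, whereas the odd part of \<open>u\<close> is small since it is continuous
  and vanishes at the origin. How small \<open>t0\<close> has to be depends on \<open>u\<close>, but the lower bound does not.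
\<close>

lemma excess_initial_mass_ge:
  assumes \<nu>: "1/2 < \<nu>" "\<nu> < 1" and u: "u \<in> C12_0" and R: "1 + 1 / (1 - \<nu>) \<le> R"
  shows "\<exists>t0. 0 < t0 \<and> t0 < 1 \<and>
    2 * exp (- 1/2) / sqrt (2 * pi) * ramp (ramp (1/2) / 2)
      \<le> integral {0..R} (\<lambda>x. front_density \<nu> (t0, x) * excess \<nu> u (t0, x))"
proof -
  define c where "c = ramp (1/2) / 2"
  have c: "0 < c" using ramp_pos[of "1/2"] by (simp add: c_def)
  have "continuous (at (0, 0) within closed_strip) (odd_part u)"
    using continuous_on_parts(1)[OF C12_0_cont(1)[OF u]] by (simp add: continuous_on_eq_continuous_within)
  then obtain d where d: "0 < d"
    "\<And>z. z \<in> closed_strip \<Longrightarrow> dist z (0, 0) < d \<Longrightarrow> dist (odd_part u z) (odd_part u (0, 0)) < c"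
    unfolding continuous_within_eps_delta using c by blast
  obtain \<tau> where \<tau>: "0 < \<tau>"
    "\<And>t x. 0 < t \<Longrightarrow> t < \<tau> \<Longrightarrow> \<bar>x - front \<nu> t\<bar> \<le> sqrt t \<Longrightarrow> 0 \<le> x \<and> 1/2 \<le> barrier \<nu> (t, x)"
    using barrier_near_front[OF \<nu>] by blast
  have "\<forall>\<^sub>F t in at_right 0. t + front \<nu> t + sqrt t < d"
    using order_tendstoD(2)[OF front_window_tendsto_0[OF \<nu>(2)] d(1)] .
  moreover have "\<forall>\<^sub>F t in at_right (0::real). 0 < t \<and> t < min 1 \<tau>"
    using eventually_at_right_real[of 0 "min 1 \<tau>"] \<tau>(1)
    unfolding greaterThanLessThan_iff by linarith
  ultimately have "\<forall>\<^sub>F t in at_right 0. t + front \<nu> t + sqrt t < d \<and> 0 < t \<and> t < min 1 \<tau>"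
    by (rule eventually_conj)
  then obtain t where t: "t + front \<nu> t + sqrt t < d" "0 < t" "t < 1" "t < \<tau>"
    using eventually_happens'[of "at_right (0::real)"] by fastforce
  define a where "a = front \<nu> t - sqrt t"
  define b where "b = front \<nu> t + sqrt t"
  have front1: "front \<nu> t \<le> 1 / (1 - \<nu>)"
    unfolding front_def using t \<nu> by (intro divide_right_mono powr_le1) auto
  have sub: "{a..b} \<subseteq> {0..R}"
  proof -
    have "0 \<le> a" using \<tau>(2)[OF t(2,4), of a] t(2) by (simp add: a_def)
    moreover have "b \<le> R" using front1 R t by (simp add: b_def) (smt (verit) real_sqrt_le_1_iff)
    ultimately show ?thesis by auto
  qed
  define k where "k = exp (- 1/2) / sqrt (2 * pi * t) * ramp c"
  have ge: "k \<le> front_density \<nu> (t, x) * excess \<nu> u (t, x)" if x: "x \<in> {a..b}" for x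
  proof -
    have xf: "\<bar>x - front \<nu> t\<bar> \<le> sqrt t" using x by (auto simp: a_def b_def abs_le_iff)
    then have "(x - front \<nu> t)\<^sup>2 \<le> (sqrt t)\<^sup>2" by (intro abs_le_square_iff[THEN iffD1]) auto
    then have "(x - front \<nu> t)\<^sup>2 / (2 * t) \<le> 1/2" using t by (simp add: field_simps)
    then have "exp (- 1/2) / sqrt (2 * pi * t) \<le> front_density \<nu> (t, x)"
      unfolding front_density_eq[OF t(2)] using t by (intro divide_right_mono) auto
    moreover have "ramp c \<le> excess \<nu> u (t, x)"
    proof -
      note b = \<tau>(2)[OF t(2,4) xf]
      have "dist (t, x) (0, 0) \<le> \<bar>t\<bar> + \<bar>x\<bar>"
        by (simp add: dist_Pair_Pair sqrt_sum_squares_le_sum_abs)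
      also have "\<dots> < d" using b t x by (auto simp: b_def)
      finally have "\<bar>odd_part u (t, x)\<bar> < c"
        using d(2)[of "(t, x)"] t by (simp add: odd_part_def dist_real_def)
      moreover have "2 * c \<le> ramp (barrier \<nu> (t, x))"
        using ramp_mono b by (simp add: c_def)
      ultimately show ?thesis
        unfolding excess_def gap_def by (intro ramp_mono) linarith
    qed
    ultimately show ?thesis
      unfolding k_def using t ramp_nonneg front_density_nonneg by (intro mult_mono) auto
  qed
  have S: "{t} \<times> {0..R} \<subseteq> {0<..1} \<times> UNIV" "{t} \<times> {0..R} \<subseteq> {0<..} \<times> UNIV" using t by auto
  have "continuous_on ({t} \<times> {0..R}) (\<lambda>z. front_density \<nu> z * excess \<nu> u z)"
    by (intro continuous_intros continuous_on_front_density[OF \<nu>(2) S(2)] continuous_on_excess[OF \<nu>(2) u S(1)])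
  then have "continuous_on {0..R} (\<lambda>x. front_density \<nu> (t, x) * excess \<nu> u (t, x))"
    by (rule continuous_on_compose2) (auto intro!: continuous_intros)
  then have int: "(\<lambda>x. front_density \<nu> (t, x) * excess \<nu> u (t, x)) integrable_on {0..R}"
    "(\<lambda>x. front_density \<nu> (t, x) * excess \<nu> u (t, x)) integrable_on {a..b}"
    using continuous_on_subset[OF _ sub] by (blast intro: integrable_continuous_real)+
  have "2 * exp (- 1/2) / sqrt (2 * pi) * ramp (ramp (1/2) / 2) = (b - a) * k"
    using t by (simp add: a_def b_def k_def c_def real_sqrt_mult field_simps)
  also have "\<dots> = integral {a..b} (\<lambda>x. k)"
    using t by (simp add: a_def b_def)
  also have "\<dots> \<le> integral {a..b} (\<lambda>x. front_density \<nu> (t, x) * excess \<nu> u (t, x))"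
    using ge by (intro integral_le int) auto
  also have "\<dots> \<le> integral {0..R} (\<lambda>x. front_density \<nu> (t, x) * excess \<nu> u (t, x))"
    using ramp_nonneg front_density_nonneg by (intro integral_subset_le sub int) (auto simp: excess_def)
  finally show ?thesis using t by blast
qed

lemma Lpq_norm_cong:
  assumes "\<And>t x. 0 < t \<Longrightarrow> t < 1 \<Longrightarrow> f (t, x) = g (t, x)"
  shows "Lpq_norm p q f = Lpq_norm p q g"
proof -
  have "(\<lambda>t. ennpowr (\<integral>\<^sup>+ x. ennreal (\<bar>f (t, x)\<bar> powr p) \<partial>lebesgue) (q / p) * indicator {0<..<1} t)
    = (\<lambda>t. ennpowr (\<integral>\<^sup>+ x. ennreal (\<bar>g (t, x)\<bar> powr p) \<partial>lebesgue) (q / p) * indicator {0<..<1} t)"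
    using assms by (auto simp: indicator_def)
  moreover have "(\<lambda>t. ennreal (\<bar>f (t, x)\<bar> powr q) * indicator {0<..<1} t)
    = (\<lambda>t. ennreal (\<bar>g (t, x)\<bar> powr q) * indicator {0<..<1} t)" for x
    using assms by (auto simp: indicator_def)
  ultimately show ?thesis unfolding Lpq_norm_def by (simp only:)
qed

lemma source_in_Lpq:
  assumes pq: "1 < p" "1 < q" and \<nu>: "\<nu> < 1" and \<Psi>: "0 < \<Psi>"
  shows "source \<nu> \<Psi> \<in> Lpq p q"
proof -
  define B where "B = {- (1 + 1 / (1 - \<nu>))..1 + 1 / (1 - \<nu>)}"
  have abs: "\<bar>source \<nu> \<Psi> (t, x)\<bar> \<le> \<Psi> * indicator B x" for t x
    using \<Psi> by (auto simp: source_def B_def indicator_def abs_mult sgn_if)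
  have pow: "ennreal (\<bar>source \<nu> \<Psi> (t, x)\<bar> powr r) \<le> ennreal (\<Psi> powr r) * indicator B x" if "1 < r" for t x r
    using abs[of t x] that \<Psi> by (cases "x \<in> B") (auto intro!: ennreal_leI powr_mono2)
  have fin: "(\<integral>\<^sup>+ x. ennreal c * indicator B x \<partial>lborel) < top" for c
    by (simp add: nn_integral_cmult_indicator B_def ennreal_mult_less_top emeasure_lborel_Icc_eq)
  have "source \<nu> \<Psi> \<in> borel_measurable (lebesgue_on open_strip)"
    by (intro measurable_restrict_space1 measurable_completion) simp
  moreover have "Lpq_norm p q (source \<nu> \<Psi>) < top"
  proof (cases "q \<le> p")
    case True
    define A where "A = (\<integral>\<^sup>+ x. ennreal (\<Psi> powr p) * indicator B x \<partial>lborel)"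
    have "A < top" using fin by (simp add: A_def)
    have "(\<integral>\<^sup>+ t \<in> {0<..<1}. ennpowr (\<integral>\<^sup>+ x. ennreal (\<bar>source \<nu> \<Psi> (t, x)\<bar> powr p) \<partial>lborel) (q / p) \<partial>lborel)
      \<le> (\<integral>\<^sup>+ t \<in> {0<..<1::real}. ennpowr A (q / p) \<partial>lborel)"
      unfolding A_def using pq
      by (intro nn_integral_mono mult_right_mono ennpowr_mono pow) auto
    also have "\<dots> = ennpowr A (q / p)" by (simp add: nn_integral_cmult_indicator)
    also have "\<dots> < top" using \<open>A < top\<close> by simp
    finally show ?thesis using True by (simp add: Lpq_norm_def nn_integral_completion)
  next
    case False
    have "(\<integral>\<^sup>+ x. ennpowr (\<integral>\<^sup>+ t \<in> {0<..<1}. ennreal (\<bar>source \<nu> \<Psi> (t, x)\<bar> powr q) \<partial>lborel) (p / q) \<partial>lborel)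
      \<le> (\<integral>\<^sup>+ x. ennreal (\<Psi> powr p) * indicator B x \<partial>lborel)"
    proof (intro nn_integral_mono)
      fix x
      have "(\<integral>\<^sup>+ t \<in> {0<..<1}. ennreal (\<bar>source \<nu> \<Psi> (t, x)\<bar> powr q) \<partial>lborel)
        \<le> (\<integral>\<^sup>+ t \<in> {0<..<1::real}. ennreal (\<Psi> powr q) * indicator B x \<partial>lborel)"
        using pq by (intro nn_integral_mono mult_right_mono pow) auto
      also have "\<dots> = ennreal (\<Psi> powr q) * indicator B x"
        by (simp add: nn_integral_cmult_indicator)
      finally have "ennpowr (\<integral>\<^sup>+ t \<in> {0<..<1}. ennreal (\<bar>source \<nu> \<Psi> (t, x)\<bar> powr q) \<partial>lborel) (p / q)
        \<le> ennpowr (ennreal (\<Psi> powr q) * indicator B x) (p / q)"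
        using pq by (intro ennpowr_mono) auto
      also have "\<dots> = ennreal (\<Psi> powr p) * indicator B x"
        using pq \<Psi> by (simp add: ennpowr_mult_indicator powr_powr)
      finally show "ennpowr (\<integral>\<^sup>+ t \<in> {0<..<1}. ennreal (\<bar>source \<nu> \<Psi> (t, x)\<bar> powr q) \<partial>lborel) (p / q)
        \<le> ennreal (\<Psi> powr p) * indicator B x" .
    qed
    also have "\<dots> < top" by (rule fin)
    finally show ?thesis using False by (simp add: Lpq_norm_def nn_integral_completion)
  qed
  ultimately show ?thesis by (simp add: Lpq_def)
qed

theorem mainTheorem4:
  fixes \<nu> p q :: real
  assumes "1 / 2 < \<nu>" "\<nu> < 1"
    and "1 < p" "1 < q"
    and "1 / p + 1 / q \<le> 1"
  shows "Lpq_closure p q ({Lop \<nu> u | u. u \<in> C12_0} \<inter> Lpq p q) \<noteq> Lpq p q"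
proof -
  obtain \<Psi> where \<Psi>: "0 < \<Psi>" "\<And>t x. 0 < t \<Longrightarrow> t \<le> 1 \<Longrightarrow> 0 \<le> x \<Longrightarrow>
    - \<Psi> \<le> barrier_t \<nu> (t, x) + 1/2 * barrier_xx \<nu> (t, x) + t powr (- \<nu>) * barrier_x \<nu> (t, x)"
    by (rule generator_barrier_bounded_below[OF assms(1,2)]) (rule that)
  obtain C where "C < top" and C: "\<And>e. e \<in> borel_measurable borel \<Longrightarrow>
    (\<integral>\<^sup>+t\<in>{0<..<1}. (\<integral>\<^sup>+x. ennreal (sym_front_density \<nu> (t, x) * \<bar>e (t, x)\<bar>) \<partial>lborel) \<partial>lborel) \<le> C * Lpq_norm p q e"
    using kernel_pairing_bounded[OF assms(3-5) sym_front_density_measurable[of \<nu>] sym_front_density_nonneg sym_front_density_le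
        eq_refl[OF nn_integral_sym_front_density]] by blast
  obtain C' where C': "C = ennreal C'" "0 \<le> C'"
    using \<open>C < top\<close> by (cases C) auto
  define m where "m = 2 * exp (- 1/2) / sqrt (2 * pi) * ramp (ramp (1/2) / 2)"
  have "0 < ramp (ramp (1/2) / 2)" using ramp_pos[of "1/2"] by (intro ramp_pos) simp
  then have m: "0 < m" unfolding m_def by simp
  define \<epsilon> where "\<epsilon> = m / (C' + 1)"
  have \<epsilon>: "0 < \<epsilon>" "C' * \<epsilon> < m" using m C'(2) by (auto simp: \<epsilon>_def field_simps)
  have "ennreal \<epsilon> \<le> Lpq_norm p q (\<lambda>z. source \<nu> \<Psi> z - Lop \<nu> u z)" if u: "u \<in> C12_0" for u
  proof (rule ccontr)
    assume small: "\<not> ?thesis"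
    define e where "e = (\<lambda>z. indicator open_strip z * (source \<nu> \<Psi> z - Lop \<nu> u z))"
    have "Lpq_norm p q e = Lpq_norm p q (\<lambda>z. source \<nu> \<Psi> z - Lop \<nu> u z)"
      by (rule Lpq_norm_cong) (simp add: e_def)
    then have e_small: "Lpq_norm p q e \<le> ennreal \<epsilon>" using small by simp
    obtain R' where R': "\<And>t x. t \<in> {0..1} \<Longrightarrow> \<bar>x\<bar> > R' \<Longrightarrow> u (t, x) = 0"
      using C12_0_support[OF u] by blast
    define R where "R = max (1 + 1 / (1 - \<nu>)) (\<bar>R'\<bar> + 1)"
    have R: "1 + 1 / (1 - \<nu>) \<le> R" "\<And>t. t \<in> {0..1} \<Longrightarrow> u (t, R) = 0 \<and> u (t, - R) = 0"
      using R' by (auto simp: R_def)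
    obtain t0 where t0: "0 < t0" "t0 < 1" "m \<le> integral {0..R} (\<lambda>x. front_density \<nu> (t0, x) * excess \<nu> u (t0, x))"
      using excess_initial_mass_ge[OF assms(1,2) u R(1)] unfolding m_def by blast
    have "e \<in> borel_measurable borel" unfolding e_def by (rule residual_measurable[OF u])
    have "ennreal m \<le> ennreal (integral {0..R} (\<lambda>x. front_density \<nu> (t0, x) * excess \<nu> u (t0, x)))"
      using t0 by (intro ennreal_leI)
    also have "\<dots> \<le> (\<integral>\<^sup>+t\<in>{0<..<1}. (\<integral>\<^sup>+x. ennreal (sym_front_density \<nu> (t, x) * \<bar>e (t, x)\<bar>) \<partial>lborel) \<partial>lborel)"
      unfolding e_def by (rule excess_integral_le[OF assms(2) \<Psi>(1) t0(1,2) u \<Psi>(2) R])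
    also have "\<dots> \<le> C * Lpq_norm p q e" by (rule C) fact
    also have "\<dots> \<le> ennreal C' * ennreal \<epsilon>"
      unfolding C'(1) by (intro mult_left_mono e_small) simp
    also have "\<dots> = ennreal (C' * \<epsilon>)" using C' \<epsilon> by (simp add: ennreal_mult)
    finally have "m \<le> C' * \<epsilon>" using C' \<epsilon> by (simp add: ennreal_le_iff)
    then show False using \<epsilon>(2) by simp
  qed
  then have "source \<nu> \<Psi> \<notin> Lpq_closure p q ({Lop \<nu> u | u. u \<in> C12_0} \<inter> Lpq p q)"
    using \<epsilon>(1) by (auto simp: Lpq_closure_def not_less[symmetric])
  moreover have "source \<nu> \<Psi> \<in> Lpq p q"
    by (rule source_in_Lpq) (use assms \<Psi> in auto)
  ultimately show ?thesis by blast
qed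

end
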